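(* Let $N\ge 1$ and $0<\gamma_2<\gamma_1<\min\{N,2\}$. Then the following assertions hold. (i) $-\infty<m(c)\le 0$ for any $c\ge 0$. (ii) The function $c\mapsto m(c)$ is continuous at every $c>0$. (iii) $m(c)\le m(c_1)+m(c_2)$ for any $c_1,c_2\ge 0$ with $c=c_1+c_2>0$. In addition, the function $c\mapsto m(c)$ is nonincreasing on $(0,\infty)$. (iv) $\lim_{c\to 0^+}m(c)=0$ and $\lim_{c\to\infty}m(c)=-\infty$.
   Context: For $\gamma\in(0,N)$ and $u\in H^1(\mathbb{R}^N)$ write $D_\gamma(u):=\int_{\mathbb{R}^N}\int_{\mathbb{R}^N}\frac{|u(x)|^2|u(y)|^2}{|x-y|^{\gamma}}\,dx\,dy$. The energy is $E(u):=\frac12\int_{\mathbb{R}^N}|\nabla u|^2\,dx+\frac14 D_{\gamma_2}(u)-\frac14 D_{\gamma_1}(u)$. For $c\ge 0$, $S(c):=\{u\in H^1(\mathbb{R}^N):\int_{\mathbb{R}^N}|u|^2\,dx=c\}$ and $m(c):=\inf_{u\in S(c)}E(u)$. *)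

theory Defs
  imports "HOL-Analysis.Analysis"
begin

definition pderiv_vec :: "'n::finite \<Rightarrow> (real^'n \<Rightarrow> real) \<Rightarrow> real^'n \<Rightarrow> real" where
  "pderiv_vec i \<phi> x = frechet_derivative \<phi> (at x) (axis i 1)"

text \<open>
  \<open>C\<^sub>c\<^sup>\<infinity>(\<real>\<^sup>N)\<close>, real-valued. Smoothness says that every iterated partial derivative (a list of
  directions, the empty list giving \<open>\<phi>\<close> itself) is Frechet differentiable everywhere.
\<close>
definition test_functions :: "(real^'n::finite \<Rightarrow> real) set" where
  "test_functions = {\<phi>. (\<forall>is x. fold pderiv_vec is \<phi> differentiable (at x)) \<and>
     compact (closure {x. \<phi> x \<noteq> 0})}"

text \<open>
  Elements of \<open>L\<^sup>2\<close> and \<open>H\<^sup>1\<close> are Borel representatives; functions equal almost everywhere are not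
  identified, and every quantity below is invariant under such changes.
\<close>
definition L2 :: "(real^'n::finite \<Rightarrow> 'b::{second_countable_topology, real_normed_vector}) set" where
  "L2 = {f. f \<in> borel_measurable lborel \<and> integrable lborel (\<lambda>x. (norm (f x))\<^sup>2)}"

text \<open>
  Real test functions suffice for the complex-valued \<open>u\<close>, since both sides are linear in \<open>\<phi>\<close>.
\<close>
definition is_weak_gradient :: "(real^'n::finite \<Rightarrow> complex) \<Rightarrow> (real^'n \<Rightarrow> complex^'n) \<Rightarrow> bool" where
  "is_weak_gradient u g \<longleftrightarrow> (\<forall>\<phi>\<in>test_functions. \<forall>i.
     (\<integral>x. pderiv_vec i \<phi> x *\<^sub>R u x \<partial>lborel) = - (\<integral>x. \<phi> x *\<^sub>R (g x $ i) \<partial>lborel))"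

definition H1 :: "(real^'n::finite \<Rightarrow> complex) set" where
  "H1 = {u \<in> L2. \<exists>g\<in>L2. is_weak_gradient u g}"

text \<open>The choice is unique up to a null set. The norm on \<open>complex^'n\<close> is the Hermitian one.\<close>
definition weak_gradient :: "(real^'n::finite \<Rightarrow> complex) \<Rightarrow> real^'n \<Rightarrow> complex^'n" where
  "weak_gradient u = (SOME g. g \<in> L2 \<and> is_weak_gradient u g)"

definition riesz_energy :: "real \<Rightarrow> (real^'n::finite \<Rightarrow> complex) \<Rightarrow> ennreal" where
  "riesz_energy \<gamma> u = (\<integral>\<^sup>+x. \<integral>\<^sup>+y.
     ennreal ((norm (u x))\<^sup>2 * (norm (u y))\<^sup>2 / norm (x - y) powr \<gamma>) \<partial>lborel \<partial>lborel)"

text \<open>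
  The Riesz terms are extended-valued so that a divergent integral is not silently read as 0.
  For \<open>u \<in> H1\<close> and exponents in \<open>(0, min N 2)\<close> both are finite.
\<close>
definition energy :: "real \<Rightarrow> real \<Rightarrow> (real^'n::finite \<Rightarrow> complex) \<Rightarrow> ereal" where
  "energy \<gamma>\<^sub>1 \<gamma>\<^sub>2 u = ereal (1/2 * (\<integral>x. (norm (weak_gradient u x))\<^sup>2 \<partial>lborel))
     + ereal (1/4) * enn2ereal (riesz_energy \<gamma>\<^sub>2 u) - ereal (1/4) * enn2ereal (riesz_energy \<gamma>\<^sub>1 u)"

definition mass_sphere :: "real \<Rightarrow> (real^'n::finite \<Rightarrow> complex) set" where
  "mass_sphere c = {u \<in> H1. (\<integral>x. (norm (u x))\<^sup>2 \<partial>lborel) = c}"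

text \<open>
  \<open>m(c)\<close>; the type argument carries the dimension \<open>N = CARD('n)\<close>.
\<close>
definition min_energy :: "'n::finite itself \<Rightarrow> real \<Rightarrow> real \<Rightarrow> real \<Rightarrow> ereal" where
  "min_energy TYPE('n) \<gamma>\<^sub>1 \<gamma>\<^sub>2 c =
     (INF u \<in> (mass_sphere c :: (real^'n \<Rightarrow> complex) set). energy \<gamma>\<^sub>1 \<gamma>\<^sub>2 u)"

end

theory Submission imports Defs "HOL-Computational_Algebra.Polynomial" begin

text \<open>
  Rescaling the amplitude gives \<open>m(c)/c = inf {A/2 + c B/4}\<close>, where \<open>A\<close> is the kinetic term and \<open>B\<close>
  the difference of the Riesz terms of a state of mass 1. As an infimum of affine functions of \<open>c\<close>
  this quotient is concave, hence continuous as soon as it is finite. Spreading out a fixed state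
  shows that it is nonpositive; it is then nonincreasing, because a state with \<open>B > 0\<close> contributes
  a positive number and one with \<open>B \<le> 0\<close> a nonincreasing function. Subadditivity follows from
  \<open>c m(c)/c = c\<^sub>1 m(c)/c + c\<^sub>2 m(c)/c\<close>, without splitting states in space. Concentrating a fixed state
  makes \<open>B\<close> negative, which gives the limit at infinity.

  Finiteness rests on a bound for the integral of \<open>|u|\<^sup>2 |x| powr - \<gamma>\<close>. Its contribution from the ball of
  radius \<open>\<delta>\<close> is compared with that of the dilate \<open>u(2 x)\<close>, which is smaller by the factor
  \<open>2 powr (\<gamma> - N)\<close>, and the error \<open>u(2 x) - u(x)\<close> is the integral of the radial derivative
  \<open>x \<cdot> \<nabla>u(s x)\<close> over \<open>s\<close> from 1 to 2.
\<close>

section \<open>Smooth functions and test functions\<close>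

text \<open>Both Riesz terms are quartic in the amplitude, so they enter a state of mass c with the
  same factor \<open>c\<^sup>2\<close>, while the kinetic term carries c; this common power is what
  makes the quotient affine in c. The analytic core is that
  \<open>riesz_energy \<gamma>\<^sub>1\<close> at mass 1 is at most an arbitrarily small multiple of
  the kinetic term plus a constant, so that collapse to a point cannot pay. Both bounds on
  \<open>\<gamma>\<^sub>1\<close> enter there: being less than N makes the dilation a contraction,
  and being less than 2 lets the factor \<open>\<bar>x\<bar>\<^sup>2\<close> from the radial
  derivative beat the singular weight, leaving a power of \<delta> that tends to 0. The obstacle is
  that a gradient is known only through integrals against test functions. The dilation is therefore
  carried by the test function, and the formula for u(2 x) - u(x) becomes an identity almost
  everywhere only because a locally integrable function that all test functions annihilate is 0. The
  same fact frees the energy from the choice hidden in \<open>weak_gradient\<close>, and it requires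
  a supply of explicit smooth bumps.\<close>

lemma pderiv_vec_eq:
  "(f has_derivative f') (at x) \<Longrightarrow> pderiv_vec i f x = f' (axis i 1)"
  unfolding pderiv_vec_def by (metis frechet_derivative_at)

definition smooth :: "(real^'n::finite \<Rightarrow> real) \<Rightarrow> bool" where
  "smooth f \<longleftrightarrow> (\<forall>is x. fold pderiv_vec is f differentiable (at x))"

lemma test_functions_iff:
  "\<phi> \<in> test_functions \<longleftrightarrow> smooth \<phi> \<and> compact (closure {x. \<phi> x \<noteq> 0})"
  by (simp add: test_functions_def smooth_def)

text \<open>Smooth functions form the largest class of differentiable functions closed under partial
  derivatives. Exhibiting any such class that contains \<open>f\<close> replaces an induction over
  lists of directions.\<close>

lemma smooth_coinduct:
  assumes "f \<in> C" and diff: "\<And>f x. f \<in> C \<Longrightarrow> f differentiable (at x)"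
    and step: "\<And>f i. f \<in> C \<Longrightarrow> pderiv_vec i f \<in> C"
  shows "smooth f"
proof -
  have "fold pderiv_vec is f \<in> C" for "is"
    using assms(1) by (induction "is" arbitrary: f) (auto intro: step)
  then show ?thesis unfolding smooth_def using diff by blast
qed

lemma smooth_pderiv_vec: "smooth f \<Longrightarrow> smooth (pderiv_vec i f)"
  unfolding smooth_def by (metis fold_simps(2))

lemma smooth_differentiable: "smooth f \<Longrightarrow> f differentiable (at x)"
  unfolding smooth_def by (metis fold_simps(1))

lemma smooth_has_derivative: "smooth f \<Longrightarrow> (f has_derivative frechet_derivative f (at x)) (at x)"
  using smooth_differentiable frechet_derivative_works by blast

lemma smooth_continuous_on: "smooth f \<Longrightarrow> continuous_on S f"
  by (meson continuous_at_imp_continuous_on differentiable_imp_continuous_within smooth_differentiable)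

lemma pderiv_vec_add:
  assumes "f differentiable (at x)" "g differentiable (at x)"
  shows "pderiv_vec i (\<lambda>x. f x + g x) x = pderiv_vec i f x + pderiv_vec i g x"
  using pderiv_vec_eq[OF has_derivative_add[OF assms[unfolded frechet_derivative_works]]]
  by (simp add: pderiv_vec_def)

lemma pderiv_vec_mult:
  assumes "f differentiable (at x)" "g differentiable (at x)"
  shows "pderiv_vec i (\<lambda>x. f x * g x) x = pderiv_vec i f x * g x + f x * pderiv_vec i g x"
  using pderiv_vec_eq[OF has_derivative_mult[OF assms[unfolded frechet_derivative_works]]]
  by (simp add: pderiv_vec_def)

lemma pderiv_vec_affine:
  assumes "f differentiable (at (s *\<^sub>R x + h))"
  shows "pderiv_vec i (\<lambda>x. k * f (s *\<^sub>R x + h)) x = k * s * pderiv_vec i f (s *\<^sub>R x + h)"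
proof -
  let ?D = "frechet_derivative f (at (s *\<^sub>R x + h))"
  have D: "(f has_derivative ?D) (at (s *\<^sub>R x + h))"
    using assms frechet_derivative_works by blast
  have "((\<lambda>x. f (s *\<^sub>R x + h)) has_derivative (\<lambda>v. ?D (s *\<^sub>R v))) (at x)"
    by (rule has_derivative_compose[where f="\<lambda>x. s *\<^sub>R x + h", OF _ D]) (auto intro!: derivative_eq_intros)
  then have "((\<lambda>x. k * f (s *\<^sub>R x + h)) has_derivative (\<lambda>v. k * ?D (s *\<^sub>R v))) (at x)"
    by (rule has_derivative_mult_right)
  from pderiv_vec_eq[OF this, of i] show ?thesis
    using linear_scale[OF has_derivative_linear[OF D]] by (simp add: pderiv_vec_def)
qed

text \<open>Products of two smooth functions are not closed under partial derivatives, because the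
  product rule returns a sum of two products. Finite sums of such products are closed, so this is
  the class used for coinduction.\<close>

inductive_set smooth_span :: "(real^'n::finite \<Rightarrow> real) set" where
  mult: "smooth f \<Longrightarrow> smooth g \<Longrightarrow> (\<lambda>x. f x * g x) \<in> smooth_span"
| add: "f \<in> smooth_span \<Longrightarrow> g \<in> smooth_span \<Longrightarrow> (\<lambda>x. f x + g x) \<in> smooth_span"

lemma smooth_span_differentiable: "f \<in> smooth_span \<Longrightarrow> f differentiable (at x)"
  by (induction rule: smooth_span.induct)
    (simp_all add: smooth_differentiable)

lemma smooth_span_smooth:
  assumes "f \<in> smooth_span" shows "smooth f"
proof (rule smooth_coinduct[OF assms smooth_span_differentiable])
  show "pderiv_vec i f \<in> smooth_span" if "f \<in> smooth_span" for f :: "real^'n \<Rightarrow> real" and i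
    using that
  proof induction
    case (mult f g)
    have "pderiv_vec i (\<lambda>x. f x * g x) = (\<lambda>x. pderiv_vec i f x * g x + f x * pderiv_vec i g x)"
      using mult by (auto simp: pderiv_vec_mult smooth_differentiable)
    then show ?case
      using mult by (auto intro!: smooth_span.intros smooth_pderiv_vec)
  next
    case (add f g)
    have "pderiv_vec i (\<lambda>x. f x + g x) = (\<lambda>x. pderiv_vec i f x + pderiv_vec i g x)"
      using add by (auto simp: pderiv_vec_add smooth_span_differentiable)
    then show ?case using add by (auto intro: smooth_span.intros)
  qed
qed

lemma smooth_mult: "smooth f \<Longrightarrow> smooth g \<Longrightarrow> smooth (\<lambda>x. f x * g x)"
  by (rule smooth_span_smooth[OF smooth_span.mult])

lemma pderiv_vec_const: "pderiv_vec i (\<lambda>_. c) = (\<lambda>_. 0)"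
  by (simp add: pderiv_vec_def[abs_def])

lemma smooth_const: "smooth (\<lambda>_. c)"
  by (rule smooth_coinduct[of _ "range (\<lambda>c _. c)"])
    (auto simp: pderiv_vec_const)

lemma smooth_prod: "finite I \<Longrightarrow> (\<And>i. i \<in> I \<Longrightarrow> smooth (f i)) \<Longrightarrow> smooth (\<lambda>x. \<Prod>i\<in>I. f i x)"
  by (induction I rule: finite_induct) (auto intro: smooth_const smooth_mult)

text \<open>The amplitude \<open>k\<close> belongs to the coinduction class because every derivative
  contributes another factor \<open>s\<close>.\<close>

lemma smooth_affine:
  assumes "smooth f" shows "smooth (\<lambda>x. k * f (s *\<^sub>R x + h))"
proof (rule smooth_coinduct[of _ "{\<lambda>x. k * f (s *\<^sub>R x + h) |k f. smooth f}"])
  fix g assume "g \<in> {\<lambda>x. k * f (s *\<^sub>R x + h) |k f. smooth f}"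
  then obtain k f where g: "g = (\<lambda>x. k * f (s *\<^sub>R x + h))" "smooth f" by auto
  show "g differentiable at x" for x
    unfolding g
    by (intro differentiable_mult differentiable_const
        differentiable_compose[of f "\<lambda>x. s *\<^sub>R x + h"] smooth_differentiable g derivative_intros)
  have "pderiv_vec i g = (\<lambda>x. (k * s) * pderiv_vec i f (s *\<^sub>R x + h))" for i
    unfolding g using pderiv_vec_affine smooth_differentiable[OF g(2)] by blast
  then show "pderiv_vec i g \<in> {\<lambda>x. k * f (s *\<^sub>R x + h) |k f. smooth f}" for i
    using smooth_pderiv_vec[OF g(2)] by blast
qed (use assms in auto)

lemma pderiv_vec_component:
  assumes "(e has_real_derivative e') (at (s * x $ i + c))"
  shows "pderiv_vec j (\<lambda>x. e (s * x $ i + c)) x = (if i = j then s * e' else 0)"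
    and "(\<lambda>x. e (s * x $ i + c)) differentiable (at x)"
proof -
  have "((\<lambda>x. e (s * x $ i + c)) has_derivative (\<lambda>v. (s * v $ i) * e')) (at x)"
    by (rule has_derivative_eq_rhs, rule has_derivative_compose[where f="\<lambda>x. s * x $ i + c", OF _
          assms[unfolded has_field_derivative_def]])
      (auto intro!: derivative_eq_intros bounded_linear_imp_has_derivative bounded_linear_vec_nth)
  from pderiv_vec_eq[OF this, of j] differentiableI[OF this]
  show "pderiv_vec j (\<lambda>x. e (s * x $ i + c)) x = (if i = j then s * e' else 0)"
    "(\<lambda>x. e (s * x $ i + c)) differentiable (at x)"
    by (auto simp: axis_def)
qed

lemma smooth_component: "smooth (\<lambda>x. x $ i)"
proof -
  have D: "((\<lambda>t. t) has_real_derivative 1) (at t)" for t by simp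
  have eq: "pderiv_vec j (\<lambda>x. x $ i) = (\<lambda>_. if i = j then 1 else 0)" for j
    using pderiv_vec_component(1)[OF D, where s=1 and c=0 and i=i] by auto
  show ?thesis
    by (rule smooth_coinduct[of _ "insert (\<lambda>x. x $ i) (range (\<lambda>c _. c))"])
      (auto simp: eq pderiv_vec_component(2)[OF D, where s=1 and c=0 and i=i, simplified] pderiv_vec_const)
qed

section \<open>Functions flat at the origin and bumps supported on boxes\<close>

definition flat :: "real poly \<Rightarrow> real \<Rightarrow> real" where
  "flat p t = (if t > 0 then poly p (inverse t) * exp (- inverse t) else 0)"

lemma poly_exp_decay: "((\<lambda>t. poly p t * exp (- t)) \<longlongrightarrow> (0::real)) at_top"
proof -
  have "((\<lambda>t. (\<Sum>i\<le>degree p. coeff p i * (t ^ i / exp t))) \<longlongrightarrow> (\<Sum>i\<le>degree p. coeff p i * 0)) at_top"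
    by (intro tendsto_intros tendsto_power_div_exp_0)
  then show ?thesis
    by (simp add: poly_altdef exp_minus field_simps sum_distrib_right sum_divide_distrib)
qed

text \<open>The polynomial parameter keeps the family closed under differentiation: the derivative
  of p(1/t) exp(-1/t) is (p - p')(1/t) exp(-1/t) divided by the square of t, and each
  \<open>pCons 0\<close> multiplies by one factor 1/t. At the origin the right difference quotient
  is again of this form, with one extra factor 1/h, and the exponential defeats every
  polynomial.\<close>

lemma flat_has_derivative:
  "(flat p has_real_derivative flat (pCons 0 (pCons 0 (p - pderiv p))) t) (at t)"
proof -
  consider "t > 0" | "t < 0" | "t = 0" by linarith
  then show ?thesis
  proof cases
    case 1
    have "((\<lambda>t. poly p (inverse t) * exp (- inverse t)) has_real_derivative
        flat (pCons 0 (pCons 0 (p - pderiv p))) t) (at t)"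
      using 1 by (auto intro!: derivative_eq_intros DERIV_chain2[OF poly_DERIV, where g="\<lambda>t. inverse t"]
        simp: flat_def algebra_simps power2_eq_square)
    then show ?thesis
      by (rule has_field_derivative_transform_within_open[where S="{0<..}"]) (use 1 in \<open>auto simp: flat_def\<close>)
  next
    case 2
    have "((\<lambda>t. 0) has_real_derivative flat (pCons 0 (pCons 0 (p - pderiv p))) t) (at t)"
      using 2 by (auto simp: flat_def)
    then show ?thesis
      by (rule has_field_derivative_transform_within_open[where S="{..<0}"]) (use 2 in \<open>auto simp: flat_def\<close>)
  next
    case 3
    have "((\<lambda>h. flat p h / h) \<longlongrightarrow> 0) (at_right 0)"
    proof -
      have "((\<lambda>h. poly (pCons 0 p) (inverse h) * exp (- inverse h)) \<longlongrightarrow> (0::real)) (at_right 0)"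
        by (rule filterlim_compose[OF poly_exp_decay filterlim_inverse_at_top_right])
      moreover have "\<forall>\<^sub>F h in at_right 0. poly (pCons 0 p) (inverse h) * exp (- inverse h) = flat p h / h"
        by (auto simp: eventually_at_filter flat_def field_simps)
      ultimately show ?thesis by (rule Lim_transform_eventually)
    qed
    moreover have "((\<lambda>h. flat p h / h) \<longlongrightarrow> 0) (at_left 0)"
      by (rule tendsto_eventually) (auto simp: eventually_at_filter flat_def)
    ultimately have "((\<lambda>h. flat p h / h) \<longlongrightarrow> 0) (at 0)"
      using filterlim_split_at by blast
    then show ?thesis
      using 3 by (simp add: DERIV_def flat_def)
  qed
qed

lemma smooth_flat: "smooth (\<lambda>x. flat p (s * x $ i + c))"
proof -
  let ?C = "{\<lambda>x. r * flat p (s * x $ i + c) |r p. True}"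
  have D: "((\<lambda>t. r * flat p t) has_real_derivative r * flat (pCons 0 (pCons 0 (p - pderiv p))) t) (at t)" for r p t
    by (rule DERIV_cmult[OF flat_has_derivative])
  have eq: "pderiv_vec j (\<lambda>x. r * flat p (s * x $ i + c)) =
      (\<lambda>x. (if i = j then s * r else 0) * flat (pCons 0 (pCons 0 (p - pderiv p))) (s * x $ i + c))" for r p j
    by (auto simp: fun_eq_iff pderiv_vec_component(1)[OF D])
  show ?thesis
  proof (rule smooth_coinduct[of _ ?C])
    show "pderiv_vec j f \<in> ?C" if "f \<in> ?C" for f j
      using that eq by blast
    show "f differentiable (at x)" if "f \<in> ?C" for f x
      using that pderiv_vec_component(2)[OF D] by blast
    have "(\<lambda>x. flat p (s * x $ i + c)) = (\<lambda>x. 1 * flat p (s * x $ i + c))" by simp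
    then show "(\<lambda>x. flat p (s * x $ i + c)) \<in> ?C" by blast
  qed
qed

lemma flat_nonneg: "0 \<le> flat 1 t" and flat_le_1: "flat 1 t \<le> 1" and flat_pos_iff: "flat 1 t = 0 \<longleftrightarrow> t \<le> 0"
  by (auto simp: flat_def)

text \<open>The parameter \<open>s\<close> is a steepness: as it grows the bump tends to the
  indicator of the open box while staying between 0 and 1, which is the form that dominated
  convergence asks for.\<close>

definition box_bump :: "real^'n::finite \<Rightarrow> real^'n \<Rightarrow> real \<Rightarrow> real^'n \<Rightarrow> real" where
  "box_bump a b s x = (\<Prod>i\<in>UNIV. flat 1 (s * (x $ i - a $ i)) * flat 1 (s * (b $ i - x $ i)))"

lemma box_bump_eq_0_iff: "s > 0 \<Longrightarrow> box_bump a b s x = 0 \<longleftrightarrow> x \<notin> box a b"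
  by (auto simp: box_bump_def flat_pos_iff mem_box_cart mult_le_0_iff not_le not_less)

lemma box_bump_bounds: "0 \<le> box_bump a b s x" "box_bump a b s x \<le> 1"
  by (auto simp: box_bump_def intro!: prod_nonneg prod_le_1 mult_nonneg_nonneg flat_nonneg mult_le_one flat_le_1)

lemma box_bump_test_function:
  assumes "s > 0" shows "box_bump a b s \<in> test_functions"
proof -
  have "smooth (\<lambda>x. flat 1 (s * x $ i + (- s * a $ i)) * flat 1 ((- s) * x $ i + s * b $ i))" for i
    by (intro smooth_mult smooth_flat)
  then have "smooth (box_bump a b s)"
    unfolding box_bump_def[abs_def] by (intro smooth_prod) (auto simp: algebra_simps)
  moreover have "compact (closure {x. box_bump a b s x \<noteq> 0})"
    using assms by (simp add: box_bump_eq_0_iff bounded_box)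
  ultimately show ?thesis by (simp add: test_functions_iff)
qed

lemma box_bump_tendsto:
  "(\<lambda>n. box_bump a b (real n) x) \<longlonglongrightarrow> indicator (box a b) x"
proof -
  have flat_lim: "(\<lambda>n. flat 1 (real n * t)) \<longlonglongrightarrow> (if t > 0 then 1 else 0)" for t
  proof (cases "t > 0")
    case True
    then have "filterlim (\<lambda>n. real n * t) at_top sequentially"
      by (intro filterlim_at_top_mult_tendsto_pos[OF tendsto_const] filterlim_real_sequentially)
    then have "(\<lambda>n. exp (- inverse (real n * t))) \<longlonglongrightarrow> exp (- 0)"
      by (intro tendsto_intros tendsto_inverse_0_at_top)
    moreover have "\<forall>\<^sub>F n in sequentially. exp (- inverse (real n * t)) = flat 1 (real n * t)"
      using eventually_gt_at_top[of 0] by eventually_elim (use True in \<open>auto simp: flat_def\<close>)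
    ultimately show ?thesis using True by (auto intro: Lim_transform_eventually)
  next
    case False
    then have "flat 1 (real n * t) = 0" for n by (auto simp: flat_def zero_less_mult_iff)
    then show ?thesis using False by simp
  qed
  have "(\<lambda>n. box_bump a b (real n) x) \<longlonglongrightarrow> (\<Prod>i\<in>UNIV. (if x $ i - a $ i > 0 then 1 else 0) * (if b $ i - x $ i > 0 then 1 else 0))"
    unfolding box_bump_def by (intro tendsto_intros flat_lim)
  also have "(\<Prod>i\<in>UNIV. (if x $ i - a $ i > 0 then 1 else 0) * (if b $ i - x $ i > 0 then 1 else 0)) = (indicator (box a b) x :: real)"
    by (auto simp: indicator_def mem_box_cart intro!: prod.neutral)
  finally show ?thesis .
qed

section \<open>Uniqueness of the weak gradient\<close>

text \<open>The positive and the negative part of \<open>f\<close> are the densities of two measures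
  that agree and are finite on boxes. Boxes form an intersection-stable generator of the Borel sets,
  so the measures coincide, and hence so do their densities.\<close>

lemma AE_zero_if_box_integrals_zero:
  fixes f :: "'a::euclidean_space \<Rightarrow> real"
  assumes [measurable]: "f \<in> borel_measurable borel"
    and loc: "\<And>a b. set_integrable lborel (box a b) f"
    and zero: "\<And>a b. (\<integral>x. indicator (box a b) x *\<^sub>R f x \<partial>lborel) = 0"
  shows "AE x in lborel. f x = 0"
proof -
  let ?M = "density lborel (\<lambda>x. ennreal (f x))" and ?N = "density lborel (\<lambda>x. ennreal (- f x))"
  have box: "emeasure ?M (box a b) = emeasure ?N (box a b) \<and> emeasure ?M (box a b) \<noteq> \<infinity>" for a b
  proof -
    have M: "emeasure ?M (box a b) = (\<integral>\<^sup>+x. ennreal (indicator (box a b) x *\<^sub>R f x) \<partial>lborel)"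
      by (auto simp: emeasure_density indicator_def intro!: nn_integral_cong)
    have N: "emeasure ?N (box a b) = (\<integral>\<^sup>+x. ennreal (- (indicator (box a b) x *\<^sub>R f x)) \<partial>lborel)"
      by (auto simp: emeasure_density indicator_def intro!: nn_integral_cong)
    from loc[of a b, unfolded set_integrable_def]
    have fin: "emeasure ?M (box a b) \<noteq> \<infinity>" "emeasure ?N (box a b) \<noteq> \<infinity>"
      unfolding M N real_integrable_def by auto
    have "enn2real (emeasure ?M (box a b)) = enn2real (emeasure ?N (box a b))"
      using zero[of a b] unfolding M N real_lebesgue_integral_def[OF loc[of a b, unfolded set_integrable_def]] by simp
    with fin show ?thesis
      by (metis ennreal_enn2real infinity_ennreal_def less_top)
  qed
  have "?M = ?N"
  proof (rule measure_eqI_generator_eq)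
    let ?E = "range (\<lambda>(a, b). box a b :: 'a set)"
    show "Int_stable ?E"
      by (auto simp: Int_stable_def box_Int_box)
    show "?E \<subseteq> Pow UNIV" "sets ?M = sigma_sets UNIV ?E" "sets ?N = sigma_sets UNIV ?E"
      by (simp_all add: borel_eq_box)
    let ?A = "\<lambda>n::nat. box (- (real n *\<^sub>R One)) (real n *\<^sub>R One) :: 'a set"
    show "range ?A \<subseteq> ?E" by auto
    show "\<Union>(range ?A) = UNIV" by (rule UN_box_eq_UNIV)
    show "emeasure ?M (?A i) \<noteq> \<infinity>" for i using box by blast
    show "emeasure ?M X = emeasure ?N X" if "X \<in> ?E" for X using that box by auto
  qed
  then have "AE x in lborel. ennreal (f x) = ennreal (- f x)"
    by (intro sigma_finite_measure.density_unique[OF sigma_finite_lborel]) auto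
  \<comment> \<open>\<open>ennreal\<close> truncates negative numbers to 0. Whatever the sign of
    \<open>f x\<close>, one side of the equation is therefore 0, and the other side then forces
    \<open>f x = 0\<close>.\<close>
  then show ?thesis
  proof eventually_elim
    case (elim x)
    then show ?case
      by (metis ennreal_eq_0_iff ennreal_neg linorder_le_cases neg_0_le_iff_le neg_le_0_iff_le order_antisym)
  qed
qed

text \<open>Steeper and steeper bumps approximate the indicator of a box and are dominated by it, so
  vanishing test integrals give vanishing integrals over boxes.\<close>

lemma AE_zero_if_test_integrals_zero_real:
  fixes f :: "real^'n::finite \<Rightarrow> real"
  assumes [measurable]: "f \<in> borel_measurable borel"
    and loc: "\<And>a b. set_integrable lborel (box a b) f"
    and zero: "\<And>\<phi>. \<phi> \<in> test_functions \<Longrightarrow> (\<integral>x. \<phi> x *\<^sub>R f x \<partial>lborel) = 0"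
  shows "AE x in lborel. f x = 0"
proof (rule AE_zero_if_box_integrals_zero)
  fix a b :: "real^'n"
  let ?b = "\<lambda>n. box_bump a b (real (Suc n))"
  have m[measurable]: "?b n \<in> borel_measurable borel" for n
    using box_bump_test_function[of "real (Suc n)" a b]
    by (auto simp: test_functions_iff intro!: borel_measurable_continuous_onI smooth_continuous_on)
  have "(\<lambda>n. \<integral>x. ?b n x *\<^sub>R f x \<partial>lborel) \<longlonglongrightarrow> (\<integral>x. indicator (box a b) x *\<^sub>R f x \<partial>lborel)"
  proof (rule integral_dominated_convergence)
    show "integrable lborel (\<lambda>x. norm (indicator (box a b) x *\<^sub>R f x))"
      using loc[of a b] unfolding set_integrable_def by (rule integrable_norm)
    show "AE x in lborel. (\<lambda>n. ?b n x *\<^sub>R f x) \<longlonglongrightarrow> indicator (box a b) x *\<^sub>R f x"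
      using LIMSEQ_Suc[OF box_bump_tendsto[of a b]] by (intro AE_I2 tendsto_intros) auto
    show "AE x in lborel. norm (?b n x *\<^sub>R f x) \<le> norm (indicator (box a b) x *\<^sub>R f x)" for n
    proof (rule AE_I2)
      fix x
      have "\<bar>?b n x\<bar> \<le> indicator (box a b) x"
        using box_bump_bounds[of a b "real (Suc n)" x] box_bump_eq_0_iff[of "real (Suc n)" a b x]
        by (auto simp: indicator_def)
      then show "norm (?b n x *\<^sub>R f x) \<le> norm (indicator (box a b) x *\<^sub>R f x)"
        by (auto simp: abs_mult intro!: mult_right_mono)
    qed
  qed (use m in measurable)
  moreover have "(\<integral>x. ?b n x *\<^sub>R f x \<partial>lborel) = 0" for n
    by (intro zero box_bump_test_function) simp
  ultimately show "(\<integral>x. indicator (box a b) x *\<^sub>R f x \<partial>lborel) = 0"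
    by (simp add: LIMSEQ_const_iff)
qed (use assms in auto)

lemma test_function_continuous: "\<phi> \<in> test_functions \<Longrightarrow> continuous_on S \<phi>"
  by (simp add: test_functions_iff smooth_continuous_on)

lemma test_function_bound:
  assumes "\<phi> \<in> test_functions"
  obtains C R where "0 < C" "0 < R" "\<And>x. norm (\<phi> x) \<le> C * indicator (cball 0 R) x"
proof -
  have "compact (closure {x. \<phi> x \<noteq> 0})" using assms by (simp add: test_functions_iff)
  then obtain R where R: "R > 0" "closure {x. \<phi> x \<noteq> 0} \<subseteq> cball 0 R"
    by (metis bounded_subset_ballD ball_subset_cball subset_trans compact_imp_bounded)
  have "compact (\<phi> ` cball 0 R)"
    by (intro compact_continuous_image test_function_continuous assms compact_cball)
  then obtain C where C: "C > 0" "\<And>x. x \<in> cball 0 R \<Longrightarrow> norm (\<phi> x) \<le> C"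
    by (metis bounded_pos compact_imp_bounded imageI)
  have "norm (\<phi> x) \<le> C * indicator (cball 0 R) x" for x
    using C(2)[of x] R(2) closure_subset[of "{x. \<phi> x \<noteq> 0}"] by (cases "\<phi> x = 0") (auto simp: indicator_def C(1) less_imp_le)
  with that C R show ?thesis by blast
qed

lemma set_integrable_test_mult:
  fixes f :: "real^'n::finite \<Rightarrow> 'b::{banach, second_countable_topology}"
  assumes [measurable]: "f \<in> borel_measurable borel"
    and loc: "\<And>R. set_integrable lborel (cball 0 R) f" and "\<phi> \<in> test_functions"
  shows "integrable lborel (\<lambda>x. \<phi> x *\<^sub>R f x)"
proof -
  obtain C R where C: "0 < C" "0 < R" "\<And>x. norm (\<phi> x) \<le> C * indicator (cball 0 R) x"
    using test_function_bound assms(3) by blast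
  have [measurable]: "\<phi> \<in> borel_measurable borel"
    by (intro borel_measurable_continuous_onI test_function_continuous assms)
  show ?thesis
  proof (rule Bochner_Integration.integrable_bound)
    show "integrable lborel (\<lambda>x. C *\<^sub>R (indicator (cball 0 R) x *\<^sub>R f x))"
      using loc[of R] unfolding set_integrable_def by (rule integrable_scaleR_right)
    show "AE x in lborel. norm (\<phi> x *\<^sub>R f x) \<le> norm (C *\<^sub>R (indicator (cball 0 R) x *\<^sub>R f x))"
      using C(3) C(1) mult_right_mono[OF C(3) norm_ge_zero] by (intro AE_I2) (simp add: abs_mult mult.assoc)
  qed simp
qed

text \<open>Test functions are real-valued, so the hypothesis splits into one statement about the
  real part and one about the imaginary part.\<close>

lemma AE_zero_if_test_integrals_zero:
  fixes f :: "real^'n::finite \<Rightarrow> complex"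
  assumes [measurable]: "f \<in> borel_measurable borel"
    and loc: "\<And>R. set_integrable lborel (cball 0 R) f"
    and zero: "\<And>\<phi>. \<phi> \<in> test_functions \<Longrightarrow> (\<integral>x. \<phi> x *\<^sub>R f x \<partial>lborel) = 0"
  shows "AE x in lborel. f x = 0"
proof -
  have box: "set_integrable lborel (box a b) f" for a b
  proof -
    obtain R where "box a b \<subseteq> cball 0 R"
      using bounded_subset_ballD[OF bounded_box] ball_subset_cball by (metis subset_trans)
    then show ?thesis by (intro set_integrable_subset[OF loc]) auto
  qed
  have int: "integrable lborel (\<lambda>x. \<phi> x *\<^sub>R f x)" if "\<phi> \<in> test_functions" for \<phi>
    using that loc by (intro set_integrable_test_mult) auto
  have "AE x in lborel. Re (f x) = 0"
  proof (rule AE_zero_if_test_integrals_zero_real)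
    show "set_integrable lborel (box a b) (\<lambda>x. Re (f x))" for a b
      using integrable_Re[OF box[of a b, unfolded set_integrable_def]] by (simp add: set_integrable_def)
    show "(\<integral>x. \<phi> x *\<^sub>R Re (f x) \<partial>lborel) = 0" if "\<phi> \<in> test_functions" for \<phi>
      using integral_Re[OF int[OF that]] zero[OF that] by simp
  qed simp
  moreover have "AE x in lborel. Im (f x) = 0"
  proof (rule AE_zero_if_test_integrals_zero_real)
    show "set_integrable lborel (box a b) (\<lambda>x. Im (f x))" for a b
      using integrable_Im[OF box[of a b, unfolded set_integrable_def]] by (simp add: set_integrable_def)
    show "(\<integral>x. \<phi> x *\<^sub>R Im (f x) \<partial>lborel) = 0" if "\<phi> \<in> test_functions" for \<phi>
      using integral_Im[OF int[OF that]] zero[OF that] by simp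
  qed simp
  ultimately show ?thesis
    by eventually_elim (simp add: complex_eq_iff)
qed

lemma L2_measurable: "f \<in> L2 \<Longrightarrow> f \<in> borel_measurable borel"
  by (simp add: L2_def)

lemma L2_set_integrable:
  fixes f :: "real^'n::finite \<Rightarrow> 'b::{banach, second_countable_topology}"
  assumes "f \<in> L2"
  shows "set_integrable lborel (cball 0 R) f"
  unfolding set_integrable_def
proof (rule Bochner_Integration.integrable_bound)
  have [measurable]: "f \<in> borel_measurable borel" using L2_measurable[OF assms] .
  show "integrable lborel (\<lambda>x. indicator (cball 0 R) x + (norm (f x))\<^sup>2)"
    using assms by (intro Bochner_Integration.integrable_add)
      (auto simp: L2_def integrable_indicator_iff emeasure_lborel_cball_finite[unfolded infinity_ennreal_def])
  show "AE x in lborel. norm (indicator (cball 0 R) x *\<^sub>R f x) \<le> norm (indicator (cball 0 R) x + (norm (f x))\<^sup>2)"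
  proof (rule AE_I2)
    fix x
    \<comment> \<open>With t for the norm, this is the square of t - 1/2 being nonnegative, with
      room to spare. The constant 1 is integrable over the ball, which is why only local
      integrability results.\<close>
    have "norm (f x) \<le> 1 + (norm (f x))\<^sup>2"
      using sum_squares_ge_zero[of "norm (f x) - 1/2" 0] by (simp add: power2_eq_square algebra_simps)
    then show "norm (indicator (cball 0 R) x *\<^sub>R f x) \<le> norm (indicator (cball 0 R) x + (norm (f x))\<^sup>2)"
      by (auto simp: indicator_def)
  qed
  show "(\<lambda>x. indicator (cball 0 R) x *\<^sub>R f x) \<in> borel_measurable lborel"
    using L2_measurable[OF assms] by (intro borel_measurable_scaleR borel_measurable_indicator) auto
qed

lemma L2_test_mult:
  fixes f :: "real^'n::finite \<Rightarrow> 'b::{banach, second_countable_topology}"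
  shows "f \<in> L2 \<Longrightarrow> \<phi> \<in> test_functions \<Longrightarrow> integrable lborel (\<lambda>x. \<phi> x *\<^sub>R f x)"
  by (intro set_integrable_test_mult L2_set_integrable L2_measurable)

lemma L2_component:
  fixes g :: "real^'n::finite \<Rightarrow> complex^'n"
  assumes "g \<in> L2" shows "(\<lambda>x. g x $ i) \<in> L2"
proof -
  note [measurable] = L2_measurable[OF assms]
  have m[measurable]: "(\<lambda>x. g x $ i) \<in> borel_measurable borel"
    by (rule measurable_compose[OF L2_measurable[OF assms] borel_measurable_continuous_onI])
      (intro continuous_intros)
  have "integrable lborel (\<lambda>x. (norm (g x $ i))\<^sup>2)"
    by (rule Bochner_Integration.integrable_bound[of _ "\<lambda>x. (norm (g x))\<^sup>2"])
      (use assms in \<open>auto simp: L2_def intro!: power_mono Finite_Cartesian_Product.norm_nth_le AE_I2\<close>)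
  then show ?thesis by (simp add: L2_def)
qed

lemma weak_gradient_unique:
  assumes "g \<in> L2" "g' \<in> L2" "is_weak_gradient u g" "is_weak_gradient u g'"
  shows "AE x in lborel. g x = g' x"
proof -
  have "AE x in lborel. g x $ i - g' x $ i = 0" for i
  proof (rule AE_zero_if_test_integrals_zero)
    note c = assms(1,2)[THEN L2_component[of _ i]]
    show "(\<lambda>x. g x $ i - g' x $ i) \<in> borel_measurable borel"
      by (intro borel_measurable_diff c[THEN L2_measurable])
    show "set_integrable lborel (cball 0 R) (\<lambda>x. g x $ i - g' x $ i)" for R
      using set_integral_diff(1)[OF L2_set_integrable[OF c(1)] L2_set_integrable[OF c(2)], of R] .
    show "(\<integral>x. \<phi> x *\<^sub>R (g x $ i - g' x $ i) \<partial>lborel) = 0" if "\<phi> \<in> test_functions" for \<phi>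
    proof -
      have "(\<integral>x. \<phi> x *\<^sub>R (g x $ i) \<partial>lborel) = (\<integral>x. \<phi> x *\<^sub>R (g' x $ i) \<partial>lborel)"
        using assms(3,4)[unfolded is_weak_gradient_def, rule_format, OF that, of i] by simp
      then show ?thesis
        using c[THEN L2_test_mult[OF _ that]] by (simp add: scaleR_diff_right)
    qed
  qed
  then have "AE x in lborel. \<forall>i\<in>UNIV. g x $ i - g' x $ i = 0"
    by (intro AE_finite_allI) auto
  then show ?thesis by eventually_elim (simp add: vec_eq_iff)
qed

text \<open>\<open>weak_gradient\<close> is an unspecified choice. Since two candidates agree almost
  everywhere, the kinetic energy can be computed from any gradient at hand; every explicit scaling
  of a state relies on this.\<close>

lemma weak_gradient_norm:
  assumes "g \<in> L2" "is_weak_gradient u g"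
  shows "(\<integral>x. (norm (weak_gradient u x))\<^sup>2 \<partial>lborel) = (\<integral>x. (norm (g x))\<^sup>2 \<partial>lborel)"
proof -
  have "weak_gradient u \<in> L2 \<and> is_weak_gradient u (weak_gradient u)"
    unfolding weak_gradient_def
    by (rule someI[where P="\<lambda>g. g \<in> L2 \<and> is_weak_gradient u g" and x=g]) (use assms in blast)
  then have w: "weak_gradient u \<in> L2" "is_weak_gradient u (weak_gradient u)" by auto
  note [measurable] = L2_measurable[OF w(1)] L2_measurable[OF assms(1)]
  have "AE x in lborel. weak_gradient u x = g x"
    by (rule weak_gradient_unique[OF w(1) assms(1) w(2) assms(2)])
  then have "AE x in lborel. (norm (weak_gradient u x))\<^sup>2 = (norm (g x))\<^sup>2"
    by eventually_elim simp
  then show ?thesis by (intro integral_cong_AE) measurable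
qed

section \<open>Integration by parts and affine changes of variables\<close>

lemma test_functions_iff_bounded:
  "\<phi> \<in> test_functions \<longleftrightarrow> smooth \<phi> \<and> bounded {x. \<phi> x \<noteq> 0}"
  by (simp add: test_functions_iff compact_closure)

lemma test_functions_affine:
  assumes "\<phi> \<in> test_functions" "s \<noteq> 0"
  shows "(\<lambda>x. k * \<phi> (s *\<^sub>R x + h)) \<in> test_functions"
proof -
  have "{x. k * \<phi> (s *\<^sub>R x + h) \<noteq> 0} \<subseteq> (\<lambda>y. inverse s *\<^sub>R y) ` (\<lambda>y. - h + y) ` {x. \<phi> x \<noteq> 0}"
  proof
    fix x assume "x \<in> {x. k * \<phi> (s *\<^sub>R x + h) \<noteq> 0}"
    then show "x \<in> (\<lambda>y. inverse s *\<^sub>R y) ` (\<lambda>y. - h + y) ` {x. \<phi> x \<noteq> 0}"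
      using assms(2) by (intro image_eqI[of _ _ "s *\<^sub>R x"] image_eqI[of _ _ "s *\<^sub>R x + h"]) auto
  qed
  moreover have "bounded ((\<lambda>y. inverse s *\<^sub>R y) ` (\<lambda>y. - h + y) ` {x. \<phi> x \<noteq> 0})"
    using assms(1) by (intro bounded_scaling bounded_translation) (simp add: test_functions_iff_bounded)
  ultimately show ?thesis
    using assms(1) by (auto simp: test_functions_iff_bounded intro: smooth_affine bounded_subset)
qed

lemma test_functions_mult:
  assumes "smooth f" "\<phi> \<in> test_functions"
  shows "(\<lambda>x. f x * \<phi> x) \<in> test_functions"
  using assms unfolding test_functions_iff_bounded by (auto intro: smooth_mult bounded_subset)

lemma test_functions_pderiv_vec:
  assumes "\<phi> \<in> test_functions" shows "pderiv_vec i \<phi> \<in> test_functions"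
proof -
  have "pderiv_vec i \<phi> x = 0" if "x \<notin> closure {x. \<phi> x \<noteq> 0}" for x
  proof -
    have "((\<lambda>x. 0) has_derivative (\<lambda>x. 0)) (at x)" by simp
    then have "(\<phi> has_derivative (\<lambda>x. 0)) (at x)"
      by (rule has_derivative_transform_within_open[of _ _ _ _ "- closure {x. \<phi> x \<noteq> 0}"])
        (use that closure_subset[of "{x. \<phi> x \<noteq> 0}"] in auto)
    then show ?thesis by (simp add: pderiv_vec_eq)
  qed
  then have "{x. pderiv_vec i \<phi> x \<noteq> 0} \<subseteq> closure {x. \<phi> x \<noteq> 0}" by auto
  moreover have "bounded (closure {x. \<phi> x \<noteq> 0})"
    using assms by (simp add: test_functions_iff compact_imp_bounded)
  ultimately show ?thesis
    using assms by (auto simp: test_functions_iff_bounded intro: smooth_pderiv_vec bounded_subset)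
qed

lemma test_function_measurable: "\<phi> \<in> test_functions \<Longrightarrow> \<phi> \<in> borel_measurable borel"
  by (intro borel_measurable_continuous_onI test_function_continuous)

lemma test_function_L2:
  assumes "\<phi> \<in> test_functions" shows "\<phi> \<in> L2"
proof -
  obtain C R where C: "0 < C" "0 < R" "\<And>x. norm (\<phi> x) \<le> C * indicator (cball 0 R) x"
    using test_function_bound[OF assms] by blast
  note [measurable] = test_function_measurable[OF assms]
  have "integrable lborel (\<lambda>x. (norm (\<phi> x))\<^sup>2)"
  proof (rule Bochner_Integration.integrable_bound[of _ "\<lambda>x. C\<^sup>2 * indicator (cball 0 R) x"])
    show "AE x in lborel. norm ((norm (\<phi> x))\<^sup>2) \<le> norm (C\<^sup>2 * indicator (cball 0 R) x)"
    proof (rule AE_I2)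
      fix x show "norm ((norm (\<phi> x))\<^sup>2) \<le> norm (C\<^sup>2 * indicator (cball 0 R) x)"
        using power_mono[OF C(3), of x 2] by (auto simp: indicator_def power_mult_distrib)
    qed
  qed (auto simp: integrable_indicator_iff emeasure_lborel_cball_finite[unfolded infinity_ennreal_def])
  then show ?thesis by (simp add: L2_def)
qed

section \<open>Affine substitutions, Fubini bounds and integration by parts\<close>

lemma nn_integral_lborel_affine:
  fixes f :: "real^'n::finite \<Rightarrow> ennreal"
  assumes [measurable]: "f \<in> borel_measurable borel" and "s > 0"
  shows "(\<integral>\<^sup>+x. f (s *\<^sub>R x + h) \<partial>lborel) = ennreal ((1 / s) ^ CARD('n)) * (\<integral>\<^sup>+x. f x \<partial>lborel)"
proof -
  have "(\<integral>\<^sup>+x. f x \<partial>lborel) = ennreal (s ^ CARD('n)) * (\<integral>\<^sup>+x. f (s *\<^sub>R x + h) \<partial>lborel)"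
    using assms(2) by (subst lborel_affine[of s h])
     (simp_all add: nn_integral_density nn_integral_distr nn_integral_cmult add.commute)
  then show ?thesis
    using assms(2) by (simp add: mult.assoc[symmetric] ennreal_mult[symmetric] power_one_over)
qed

lemma
  fixes f :: "real^'n::finite \<Rightarrow> 'b::{banach, second_countable_topology}"
  assumes [measurable]: "f \<in> borel_measurable borel" and "s > 0"
  shows integrable_lborel_affine: "integrable lborel (\<lambda>x. f (s *\<^sub>R x + h)) \<longleftrightarrow> integrable lborel f"
    and integral_lborel_affine:
      "(\<integral>x. f (s *\<^sub>R x + h) \<partial>lborel) = ((1 / s) ^ CARD('n)) *\<^sub>R (\<integral>x. f x \<partial>lborel)"
proof -
  have "integrable lborel f \<longleftrightarrow> integrable (density (distr lborel borel (\<lambda>x. h + s *\<^sub>R x)) (\<lambda>_. ennreal (\<bar>s\<bar> ^ CARD('n)))) f"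
    using assms(2) by (subst lborel_affine[of s h]) (simp_all add: ennreal_power)
  also have "\<dots> \<longleftrightarrow> integrable lborel (\<lambda>x. f (s *\<^sub>R x + h))"
    using assms(2) integrable_scaleR_right[of "inverse (s ^ CARD('n))" lborel "\<lambda>x. s ^ CARD('n) *\<^sub>R f (h + s *\<^sub>R x)"]
    by (auto simp: integrable_density integrable_distr_eq add.commute)
  finally show "integrable lborel (\<lambda>x. f (s *\<^sub>R x + h)) \<longleftrightarrow> integrable lborel f" ..
  have "(\<integral>x. f x \<partial>lborel) = (\<integral>x. f x \<partial>density (distr lborel borel (\<lambda>x. h + s *\<^sub>R x)) (\<lambda>_. ennreal (\<bar>s\<bar> ^ CARD('n))))"
    using assms(2) by (subst lborel_affine[of s h]) (simp_all add: ennreal_power)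
  also have "\<dots> = (s ^ CARD('n)) *\<^sub>R (\<integral>x. f (s *\<^sub>R x + h) \<partial>lborel)"
    using assms(2) by (simp add: integral_density integral_distr add.commute)
  finally show "(\<integral>x. f (s *\<^sub>R x + h) \<partial>lborel) = ((1 / s) ^ CARD('n)) *\<^sub>R (\<integral>x. f x \<partial>lborel)"
    using assms(2) by (simp add: power_one_over)
qed

text \<open>Every exchange of integrals over s and x below has this shape: s runs over a compact
  interval and the slices have a norm bounded uniformly in s.\<close>

lemma integrable_pair_lborelI:
  fixes F :: "real \<times> (real^'n::finite) \<Rightarrow> 'b::{banach, second_countable_topology}"
  assumes [measurable]: "F \<in> borel_measurable (lborel \<Otimes>\<^sub>M lborel)"
    and "\<And>s. (\<integral>\<^sup>+x. norm (F (s, x)) \<partial>lborel) \<le> K * indicator {a..b} s" "K < \<infinity>"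
  shows "integrable (lborel \<Otimes>\<^sub>M lborel) F"
proof (rule integrableI_bounded)
  have "(\<integral>\<^sup>+p. norm (F p) \<partial>(lborel \<Otimes>\<^sub>M lborel)) = (\<integral>\<^sup>+s. \<integral>\<^sup>+x. norm (F (s, x)) \<partial>lborel \<partial>lborel)"
    by (rule lborel.nn_integral_fst[symmetric]) measurable
  also have "\<dots> \<le> (\<integral>\<^sup>+s. K * indicator {a..b} s \<partial>lborel)"
    by (intro nn_integral_mono assms)
  also have "\<dots> < \<infinity>" using assms(3)
    by (simp add: nn_integral_cmult_indicator emeasure_lborel_Icc_eq ennreal_mult_less_top)
  finally show "(\<integral>\<^sup>+p. norm (F p) \<partial>(lborel \<Otimes>\<^sub>M lborel)) < \<infinity>" .
qed measurable

lemma nn_integral_bound_indicator_finite: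
  fixes f :: "real^'n::finite \<Rightarrow> 'b::{banach, second_countable_topology}"
  assumes "set_integrable lborel (cball 0 R) f"
  shows "(\<integral>\<^sup>+x. ennreal (C * (indicator (cball 0 R) x * norm (f x))) \<partial>lborel) < \<infinity>"
proof -
  have "integrable lborel (\<lambda>x. C * norm (indicator (cball 0 R) x *\<^sub>R f x))"
    using integrable_norm[OF assms[unfolded set_integrable_def]] by (rule integrable_mult_right)
  also have "(\<lambda>x. C * norm (indicator (cball 0 R) x *\<^sub>R f x)) = (\<lambda>x. C * (indicator (cball 0 R) x * norm (f x)))"
    by auto
  finally show ?thesis
    unfolding real_integrable_def by (metis infinity_ennreal_def less_top)
qed

text \<open>Integrate the identity \<phi>(x + e) - \<phi>(x) = integral of the partial derivative at
  x + s e over s from 0 to 1. Translation invariance makes the left side 0 and, after Fubini, the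
  right side the integral in question. No slicing into coordinate lines is involved.\<close>

lemma integral_pderiv_vec_test_function:
  fixes \<phi> :: "real^'n::finite \<Rightarrow> real"
  assumes "\<phi> \<in> test_functions"
  shows "(\<integral>x. pderiv_vec i \<phi> x \<partial>lborel) = 0"
proof -
  define \<theta> where "\<theta> = pderiv_vec i \<phi>"
  let ?e = "axis i (1::real) :: real^'n"
  have \<theta>: "\<theta> \<in> test_functions" unfolding \<theta>_def by (rule test_functions_pderiv_vec[OF assms])
  note [measurable] = test_function_measurable[OF \<theta>] test_function_measurable[OF assms]
  have int: "integrable lborel \<phi>" "integrable lborel \<theta>"
    using set_integrable_test_mult[of "\<lambda>_. 1::real"] assms \<theta>
    by (auto simp: set_integrable_def integrable_indicator_iff emeasure_lborel_cball_finite[unfolded infinity_ennreal_def])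
  define F where "F = (\<lambda>(s::real, x). indicator {0..1} s *\<^sub>R \<theta> (1 *\<^sub>R x + s *\<^sub>R ?e))"
  have F: "integrable (lborel \<Otimes>\<^sub>M lborel) F"
  proof (rule integrable_pair_lborelI)
    show "F \<in> borel_measurable (lborel \<Otimes>\<^sub>M lborel)"
      unfolding F_def by measurable
    show "(\<integral>\<^sup>+x. norm (F (s, x)) \<partial>lborel) \<le> (\<integral>\<^sup>+x. norm (\<theta> x) \<partial>lborel) * indicator {0..1} s" for s
      using nn_integral_lborel_affine[of "\<lambda>x. norm (\<theta> x)" 1 "s *\<^sub>R ?e"]
      by (auto simp: F_def indicator_def)
    show "(\<integral>\<^sup>+x. norm (\<theta> x) \<partial>lborel) < \<infinity>"
      using int(2) by (simp add: integrable_iff_bounded)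
  qed
  have FTC: "(\<integral>s. F (s, x) \<partial>lborel) = \<phi> (x + ?e) - \<phi> x" for x
  proof -
    have "(\<integral>s. indicator {0..1} s *\<^sub>R \<theta> (x + s *\<^sub>R ?e) \<partial>lborel) = \<phi> (x + 1 *\<^sub>R ?e) - \<phi> (x + 0 *\<^sub>R ?e)"
    proof (rule integral_FTC_Icc)
      show "((\<lambda>s. \<phi> (x + s *\<^sub>R ?e)) has_vector_derivative \<theta> (x + s *\<^sub>R ?e)) (at s within {0..1})" for s
      proof -
        have D: "(\<phi> has_derivative frechet_derivative \<phi> (at (x + s *\<^sub>R ?e))) (at (x + s *\<^sub>R ?e))"
          using assms by (simp add: smooth_has_derivative test_functions_iff)
        have "((\<lambda>s. \<phi> (x + s *\<^sub>R ?e)) has_derivative (\<lambda>t. frechet_derivative \<phi> (at (x + s *\<^sub>R ?e)) (t *\<^sub>R ?e))) (at s)"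
          by (rule has_derivative_compose[where f="\<lambda>s. x + s *\<^sub>R ?e", OF _ D]) (auto intro!: derivative_eq_intros)
        then have "((\<lambda>s. \<phi> (x + s *\<^sub>R ?e)) has_derivative (\<lambda>t. t *\<^sub>R \<theta> (x + s *\<^sub>R ?e))) (at s)"
          using linear_scale[OF has_derivative_linear[OF D]] by (simp add: \<theta>_def pderiv_vec_def)
        then show ?thesis
          by (simp add: has_vector_derivative_def has_derivative_at_withinI)
      qed
      show "continuous_on {0..1} (\<lambda>s. \<theta> (x + s *\<^sub>R ?e))"
        by (rule continuous_on_compose2[OF test_function_continuous[OF \<theta>, of UNIV]]) (auto intro!: continuous_intros)
    qed simp
    then show ?thesis by (simp add: F_def)
  qed
  have "(\<integral>x. \<phi> (x + ?e) - \<phi> x \<partial>lborel) = (\<integral>x. \<integral>s. F (s, x) \<partial>lborel \<partial>lborel)"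
    by (simp add: FTC)
  also have "\<dots> = (\<integral>s. \<integral>x. F (s, x) \<partial>lborel \<partial>lborel)"
    by (rule lborel_pair.Fubini_integral) (use F in simp)
  also have "\<dots> = (\<integral>s. indicator {0..1::real} s *\<^sub>R (\<integral>x. \<theta> x \<partial>lborel) \<partial>lborel)"
    by (rule Bochner_Integration.integral_cong)
      (use integral_lborel_affine[of \<theta> 1] in \<open>auto simp: F_def\<close>)
  also have "\<dots> = (\<integral>x. \<theta> x \<partial>lborel)"
    by (simp del: real_scaleR_def)
  finally show ?thesis
    using integral_lborel_affine[of \<phi> 1 ?e] integrable_lborel_affine[of \<phi> 1 ?e] int by (simp add: \<theta>_def)
qed

text \<open>The product of two test functions is a test function, so the product rule together with
  the vanishing integral of a derivative is the integration by parts.\<close>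

lemma is_weak_gradient_test_function:
  fixes \<phi> :: "real^'n::finite \<Rightarrow> real"
  assumes "\<phi> \<in> test_functions"
  shows "is_weak_gradient (\<lambda>x. of_real (\<phi> x)) (\<lambda>x. \<chi> i. of_real (pderiv_vec i \<phi> x))"
  unfolding is_weak_gradient_def
proof (intro ballI allI)
  fix \<psi> :: "real^'n \<Rightarrow> real" and i assume \<psi>: "\<psi> \<in> test_functions"
  have s: "smooth \<phi>" "smooth \<psi>" using assms \<psi> by (auto simp: test_functions_iff)
  have "(\<integral>x. pderiv_vec i (\<lambda>x. \<psi> x * \<phi> x) x \<partial>lborel) = 0"
    by (intro integral_pderiv_vec_test_function test_functions_mult s assms)
  also have "pderiv_vec i (\<lambda>x. \<psi> x * \<phi> x) = (\<lambda>x. pderiv_vec i \<psi> x * \<phi> x + \<psi> x * pderiv_vec i \<phi> x)"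
    by (rule ext) (intro pderiv_vec_mult smooth_differentiable s)
  also have "(\<integral>x. pderiv_vec i \<psi> x * \<phi> x + \<psi> x * pderiv_vec i \<phi> x \<partial>lborel) =
    (\<integral>x. pderiv_vec i \<psi> x * \<phi> x \<partial>lborel) + (\<integral>x. \<psi> x * pderiv_vec i \<phi> x \<partial>lborel)"
    using L2_test_mult[OF test_function_L2[OF assms] test_functions_pderiv_vec[OF \<psi>]]
      L2_test_mult[OF test_function_L2[OF test_functions_pderiv_vec[OF assms]] \<psi>]
    by (intro Bochner_Integration.integral_add) auto
  finally show "(\<integral>x. pderiv_vec i \<psi> x *\<^sub>R complex_of_real (\<phi> x) \<partial>lborel) =
     - (\<integral>x. \<psi> x *\<^sub>R ((\<chi> i. complex_of_real (pderiv_vec i \<phi> x)) $ i) \<partial>lborel)"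
    by (simp add: scaleR_conv_of_real flip: of_real_mult)
qed

text \<open>The substitution is moved to the test function. One statement covers changes of
  amplitude (s = 1, h = 0), translations (k = s = 1) and dilations (h = 0).\<close>

lemma is_weak_gradient_affine:
  fixes u :: "real^'n::finite \<Rightarrow> complex"
  assumes u: "u \<in> L2" and g: "g \<in> L2" and w: "is_weak_gradient u g" and "s > 0"
  shows "is_weak_gradient (\<lambda>x. k *\<^sub>R u (s *\<^sub>R x + h)) (\<lambda>x. (k * s) *\<^sub>R g (s *\<^sub>R x + h))"
  unfolding is_weak_gradient_def
proof (intro ballI allI)
  fix \<phi> :: "real^'n \<Rightarrow> real" and i assume \<phi>: "\<phi> \<in> test_functions"
  \<comment> \<open>The test function composed with the inverse affine map; the factor 1 only
    matches the shape of the closure lemma for affine maps.\<close>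
  define \<psi> where "\<psi> = (\<lambda>x. 1 * \<phi> (inverse s *\<^sub>R x + (- inverse s *\<^sub>R h)))"
  have \<psi>: "\<psi> \<in> test_functions" unfolding \<psi>_def using \<open>s > 0\<close> by (intro test_functions_affine \<phi>) auto
  have \<phi>_eq: "\<phi> x = \<psi> (s *\<^sub>R x + h)" for x
    using \<open>s > 0\<close> by (simp add: \<psi>_def algebra_simps)
  have d\<phi>: "pderiv_vec i \<phi> x = s * pderiv_vec i \<psi> (s *\<^sub>R x + h)" for x
    using \<open>s > 0\<close> \<phi> unfolding \<psi>_def
    by (subst pderiv_vec_affine) (auto simp: smooth_differentiable test_functions_iff algebra_simps)
  note [measurable] = L2_measurable[OF u] L2_measurable[OF L2_component[OF g]]
    test_function_measurable[OF \<psi>] test_function_measurable[OF test_functions_pderiv_vec[OF \<psi>]]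
  have "(\<integral>x. pderiv_vec i \<phi> x *\<^sub>R k *\<^sub>R u (s *\<^sub>R x + h) \<partial>lborel) =
     (\<integral>x. (s * k) *\<^sub>R (pderiv_vec i \<psi> (s *\<^sub>R x + h) *\<^sub>R u (s *\<^sub>R x + h)) \<partial>lborel)"
    by (simp add: d\<phi> mult_ac)
  also have "\<dots> = (s * k * (1 / s) ^ CARD('n)) *\<^sub>R (\<integral>x. pderiv_vec i \<psi> x *\<^sub>R u x \<partial>lborel)"
    using integral_lborel_affine[of "\<lambda>x. pderiv_vec i \<psi> x *\<^sub>R u x" s h] \<open>s > 0\<close>
    by (simp del: scaleR_scaleR add: scaleR_scaleR[symmetric, of "s * k"])
  also have "(\<integral>x. pderiv_vec i \<psi> x *\<^sub>R u x \<partial>lborel) = - (\<integral>x. \<psi> x *\<^sub>R (g x $ i) \<partial>lborel)"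
    using w \<psi> unfolding is_weak_gradient_def by blast
  also have "(s * k * (1 / s) ^ CARD('n)) *\<^sub>R - (\<integral>x. \<psi> x *\<^sub>R (g x $ i) \<partial>lborel) =
     - (\<integral>x. (s * k) *\<^sub>R (\<psi> (s *\<^sub>R x + h) *\<^sub>R (g (s *\<^sub>R x + h) $ i)) \<partial>lborel)"
    using integral_lborel_affine[of "\<lambda>x. \<psi> x *\<^sub>R (g x $ i)" s h] \<open>s > 0\<close>
    by (simp del: scaleR_scaleR add: scaleR_scaleR[symmetric, of "s * k"])
  also have "\<dots> = - (\<integral>x. \<phi> x *\<^sub>R (((k * s) *\<^sub>R g (s *\<^sub>R x + h)) $ i) \<partial>lborel)"
    by (simp add: \<phi>_eq[symmetric] mult_ac)
  finally show "(\<integral>x. pderiv_vec i \<phi> x *\<^sub>R k *\<^sub>R u (s *\<^sub>R x + h) \<partial>lborel) =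
    - (\<integral>x. \<phi> x *\<^sub>R (((k * s) *\<^sub>R g (s *\<^sub>R x + h)) $ i) \<partial>lborel)" .
qed

lemma L2_affine:
  fixes u :: "real^'n::finite \<Rightarrow> 'b::{banach, second_countable_topology}"
  assumes u: "u \<in> L2" and "s > 0"
  shows "(\<lambda>x. k *\<^sub>R u (s *\<^sub>R x + h)) \<in> L2"
    and "(\<integral>x. (norm (k *\<^sub>R u (s *\<^sub>R x + h)))\<^sup>2 \<partial>lborel) = k\<^sup>2 * (1 / s) ^ CARD('n) * (\<integral>x. (norm (u x))\<^sup>2 \<partial>lborel)"
proof -
  note [measurable] = L2_measurable[OF u]
  have "integrable lborel (\<lambda>x. (norm (u (s *\<^sub>R x + h)))\<^sup>2)"
    using u \<open>s > 0\<close> integrable_lborel_affine[of "\<lambda>x. (norm (u x))\<^sup>2" s h] by (simp add: L2_def)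
  then show "(\<lambda>x. k *\<^sub>R u (s *\<^sub>R x + h)) \<in> L2"
    by (simp add: L2_def power_mult_distrib)
  show "(\<integral>x. (norm (k *\<^sub>R u (s *\<^sub>R x + h)))\<^sup>2 \<partial>lborel) = k\<^sup>2 * (1 / s) ^ CARD('n) * (\<integral>x. (norm (u x))\<^sup>2 \<partial>lborel)"
    using \<open>s > 0\<close> integral_lborel_affine[of "\<lambda>x. (norm (u x))\<^sup>2" s h] by (simp add: power_mult_distrib)
qed

section \<open>Dilations of weakly differentiable functions\<close>

lemma borel_measurable_vec_component [measurable (raw)]:
  fixes f :: "'a \<Rightarrow> ('b::real_normed_vector) ^ 'n::finite"
  assumes "f \<in> borel_measurable M" shows "(\<lambda>x. f x $ i) \<in> borel_measurable M"
  by (rule measurable_compose[OF assms borel_measurable_continuous_onI]) (intro continuous_intros)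

lemma norm_sum_scaleR_vec_le:
  fixes x :: "real^'n::finite" and z :: "complex^'n"
  shows "norm (\<Sum>i\<in>UNIV. x $ i *\<^sub>R z $ i) \<le> norm x * norm z"
proof -
  have "norm (\<Sum>i\<in>UNIV. x $ i *\<^sub>R z $ i) \<le> (\<Sum>i\<in>UNIV. \<bar>x $ i\<bar> * \<bar>norm (z $ i)\<bar>)"
    by (rule order_trans[OF norm_sum]) simp
  also have "\<dots> \<le> L2_set (\<lambda>i. x $ i) UNIV * L2_set (\<lambda>i. norm (z $ i)) UNIV"
    by (rule L2_set_mult_ineq)
  also have "\<dots> = norm x * norm z"
    by (simp add: norm_vec_def L2_set_def)
  finally show ?thesis .
qed

lemma integrable_dilated_pairing:
  fixes g :: "real^'n::finite \<Rightarrow> complex^'n" and \<theta> :: "real^'n \<Rightarrow> real"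
  assumes g: "g \<in> L2" and [measurable]: "\<theta> \<in> borel_measurable borel"
    and \<theta>: "\<And>x. norm (\<theta> x) \<le> C * indicator (cball 0 R) x" and "0 < C" "0 < R"
  shows "integrable (lborel \<Otimes>\<^sub>M lborel)
    (\<lambda>(s::real, x). indicator {1..2} s *\<^sub>R \<theta> x *\<^sub>R (\<Sum>i\<in>UNIV. x $ i *\<^sub>R g (s *\<^sub>R x) $ i))"
    (is "integrable _ ?F")
proof (rule integrable_pair_lborelI)
  have [measurable]: "g \<in> borel_measurable borel"
    using L2_measurable[OF g] by auto
  show "?F \<in> borel_measurable (lborel \<Otimes>\<^sub>M lborel)"
    by measurable
  let ?K = "\<integral>\<^sup>+x. ennreal (C * R * (indicator (cball 0 (2 * R)) x * norm (g x))) \<partial>lborel"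
  have m: "(\<lambda>x. ennreal (C * R * (indicator (cball 0 (2 * R)) x * norm (g x)))) \<in> borel_measurable borel"
    by (intro measurable_compose[OF _ measurable_ennreal] borel_measurable_times borel_measurable_const
        borel_measurable_indicator borel_measurable_norm) auto
  show "?K < \<infinity>"
    by (rule nn_integral_bound_indicator_finite[OF L2_set_integrable[OF g]])
  show "(\<integral>\<^sup>+x. norm (?F (s, x)) \<partial>lborel) \<le> ?K * indicator {1..2} s" for s
  proof (cases "s \<in> {1..2}")
    case True
    have "norm (?F (s, x)) \<le> C * R * (indicator (cball 0 (2 * R)) (s *\<^sub>R x) * norm (g (s *\<^sub>R x)))" for x
    proof (cases "x \<in> cball 0 R")
      case xR: True
      then have "s *\<^sub>R x \<in> cball 0 (2 * R)"
        using True by (auto intro!: mult_mono)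
      moreover have "norm (?F (s, x)) \<le> C * (R * norm (g (s *\<^sub>R x)))"
      proof -
        have "norm (?F (s, x)) = norm (\<theta> x) * norm (\<Sum>i\<in>UNIV. x $ i *\<^sub>R g (s *\<^sub>R x) $ i)"
          using True by simp
        also have "\<dots> \<le> C * (norm x * norm (g (s *\<^sub>R x)))"
          using \<theta>[of x] xR \<open>0 < C\<close> by (intro mult_mono norm_sum_scaleR_vec_le) auto
        also have "\<dots> \<le> C * (R * norm (g (s *\<^sub>R x)))"
          using xR \<open>0 < C\<close> by (intro mult_left_mono mult_right_mono) auto
        finally show ?thesis .
      qed
      ultimately show ?thesis by (simp add: mult.assoc)
    next
      case False
      then have "\<theta> x = 0" using \<theta>[of x] by simp
      then show ?thesis using \<open>0 < C\<close> \<open>0 < R\<close> by simp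
    qed
    then have "(\<integral>\<^sup>+x. norm (?F (s, x)) \<partial>lborel) \<le>
        (\<integral>\<^sup>+x. ennreal (C * R * (indicator (cball 0 (2 * R)) (s *\<^sub>R x + 0) * norm (g (s *\<^sub>R x + 0)))) \<partial>lborel)"
      by (intro nn_integral_mono ennreal_leI) simp
    also have "\<dots> = ennreal ((1 / s) ^ CARD('n)) * ?K"
      using True m by (subst nn_integral_lborel_affine[where
          f="\<lambda>x. ennreal (C * R * (indicator (cball 0 (2 * R)) x * norm (g x)))"]) auto
    also have "\<dots> \<le> 1 * ?K"
      using True by (intro mult_right_mono) (auto intro!: power_le_one simp: power_one_over)
    finally show ?thesis using True by simp
  qed simp
qed

lemma frechet_derivative_eq_sum_pderiv_vec:
  assumes "\<phi> differentiable (at x)"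
  shows "frechet_derivative \<phi> (at x) v = (\<Sum>i\<in>UNIV. v $ i * pderiv_vec i \<phi> x)"
proof -
  have lin: "linear (frechet_derivative \<phi> (at x))"
    using assms frechet_derivative_works has_derivative_linear by blast
  have "frechet_derivative \<phi> (at x) v = frechet_derivative \<phi> (at x) (\<Sum>i\<in>UNIV. v $ i *\<^sub>R axis i 1)"
    by (simp add: basis_expansion flip: scalar_mult_eq_scaleR)
  also have "\<dots> = (\<Sum>i\<in>UNIV. v $ i * pderiv_vec i \<phi> x)"
    by (simp add: linear_sum[OF lin] linear_scale[OF lin] pderiv_vec_def)
  finally show ?thesis .
qed

lemma pderiv_vec_component_mult:
  assumes "\<phi> differentiable (at x)"
  shows "pderiv_vec i (\<lambda>x. x $ i * \<phi> x) x = \<phi> x + x $ i * pderiv_vec i \<phi> x"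
proof -
  have "((\<lambda>x. x $ i) has_derivative (\<lambda>v. v $ i)) (at x)"
    by (intro bounded_linear_imp_has_derivative bounded_linear_vec_nth)
  then have "pderiv_vec i (\<lambda>x. x $ i) x = 1" "(\<lambda>x. x $ i) differentiable (at x)"
    by (auto simp: pderiv_vec_eq axis_def intro: differentiableI)
  then show ?thesis using assms by (simp add: pderiv_vec_mult)
qed

text \<open>The radial derivative of a dilated test function is a divergence, which is what a weak
  gradient can be tested against.\<close>
lemma dilation_has_vector_derivative:
  fixes \<phi> :: "real^'n::finite \<Rightarrow> real"
  assumes "smooth \<phi>" "s > 0"
  shows "((\<lambda>s. (1 / s) ^ CARD('n) * \<phi> ((1 / s) *\<^sub>R x)) has_vector_derivative
     - ((1 / s) ^ Suc CARD('n) * (\<Sum>i\<in>UNIV. pderiv_vec i (\<lambda>x. x $ i * \<phi> x) ((1 / s) *\<^sub>R x)))) (at s within S)"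
proof -
  let ?y = "(1 / s) *\<^sub>R x" and ?n = "CARD('n)"
  let ?D = "\<Sum>i\<in>UNIV. ?y $ i * pderiv_vec i \<phi> ?y"
  have D: "(\<phi> has_derivative frechet_derivative \<phi> (at ?y)) (at ?y)"
    by (rule smooth_has_derivative[OF assms(1)])
  have "((\<lambda>s. \<phi> ((1 / s) *\<^sub>R x)) has_derivative (\<lambda>t. frechet_derivative \<phi> (at ?y) ((- (t / s\<^sup>2)) *\<^sub>R x))) (at s)"
    by (rule has_derivative_compose[where f="\<lambda>s. (1 / s) *\<^sub>R x", OF _ D])
      (use assms(2) in \<open>auto intro!: derivative_eq_intros simp: power2_eq_square\<close>)
  also have "(\<lambda>t. frechet_derivative \<phi> (at ?y) ((- (t / s\<^sup>2)) *\<^sub>R x)) = (\<lambda>t. - (1 / s) * ?D * t)"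
    using assms(2)
    by (auto simp: frechet_derivative_eq_sum_pderiv_vec[OF smooth_differentiable[OF assms(1)]] power2_eq_square
        sum_distrib_left sum_distrib_right sum_negf[symmetric] intro!: sum.cong)
  finally have 1: "((\<lambda>s. \<phi> ((1 / s) *\<^sub>R x)) has_real_derivative - (1 / s) * ?D) (at s)"
    by (simp only: has_field_derivative_def)
  have "((\<lambda>s. (1 / s) ^ ?n) has_real_derivative (- (real ?n * (1 / s) ^ Suc ?n))) (at s)"
  proof -
    obtain k where k: "?n = Suc k" using not0_implies_Suc[of ?n] by auto
    have "((\<lambda>s. 1 / s) has_real_derivative - ((1 / s) * (1 / s))) (at s)"
      using assms(2) by (auto intro!: derivative_eq_intros simp: power2_eq_square)
    from DERIV_power[OF this, of ?n] show ?thesis by (simp add: k mult_ac)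
  qed
  from DERIV_mult[OF this 1] have "((\<lambda>s. (1 / s) ^ ?n * \<phi> ((1 / s) *\<^sub>R x)) has_real_derivative
     - ((1 / s) ^ Suc ?n * (real ?n * \<phi> ?y + ?D))) (at s)"
    by (simp add: algebra_simps)
  also have "real ?n * \<phi> ?y + ?D = (\<Sum>i\<in>UNIV. pderiv_vec i (\<lambda>x. x $ i * \<phi> x) ?y)"
    by (simp add: pderiv_vec_component_mult smooth_differentiable[OF assms(1)] sum.distrib)
  finally show ?thesis
    by (simp add: has_real_derivative_iff_has_vector_derivative has_vector_derivative_at_within)
qed

text \<open>As \<open>u\<close> has no classical derivative, the fundamental theorem of calculus in
  s is applied to the dilated test function, s to the power -N times \<phi>(x / s). Its s-derivative
  is a divergence in x, against which \<open>u\<close> may be integrated by parts; rescaling x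
  afterwards moves the dilation from the test function to \<open>g\<close>.\<close>

lemma dilation_difference_tested:
  fixes u :: "real^'n::finite \<Rightarrow> complex"
  assumes u: "u \<in> L2" and g: "g \<in> L2" and w: "is_weak_gradient u g" and \<phi>: "\<phi> \<in> test_functions"
  shows "(\<integral>x. \<phi> x *\<^sub>R (u (2 *\<^sub>R x) - u x) \<partial>lborel) =
    (\<integral>s. indicator {1..2} s *\<^sub>R (\<integral>x. \<phi> x *\<^sub>R (\<Sum>i\<in>UNIV. x $ i *\<^sub>R g (s *\<^sub>R x) $ i) \<partial>lborel) \<partial>lborel)"
proof -
  let ?n = "CARD('n)"
  define \<psi> where "\<psi> i = (\<lambda>x. x $ i * \<phi> x)" for i
  have sm: "smooth \<phi>" using \<phi> by (simp add: test_functions_iff)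
  have \<psi>: "\<psi> i \<in> test_functions" for i
    unfolding \<psi>_def by (intro test_functions_mult smooth_component \<phi>)
  define d where "d = (\<lambda>x. \<Sum>i\<in>UNIV. pderiv_vec i (\<psi> i) x)"
  define D where "D s x = - ((1 / s) ^ Suc ?n * d ((1 / s) *\<^sub>R x))" for s x
  have d: "continuous_on UNIV d"
    unfolding d_def by (intro continuous_on_sum test_function_continuous test_functions_pderiv_vec \<psi>)
  note [measurable] = L2_measurable[OF u] test_function_measurable[OF \<phi>] borel_measurable_continuous_onI[OF d]
    L2_measurable[OF g]
  obtain C R where C: "0 < C" "0 < R" "\<And>x. norm (d x) \<le> C * indicator (cball 0 R) x"
  proof -
    have "\<exists>C R. 0 < C \<and> 0 < R \<and> (\<forall>x. norm (pderiv_vec i (\<psi> i) x) \<le> C * indicator (cball 0 R) x)" for i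
      using test_function_bound[OF test_functions_pderiv_vec[OF \<psi>[of i], of i]] by metis
    then obtain C R where CR: "\<And>i. 0 < C i \<and> 0 < R i"
        "\<And>i x. norm (pderiv_vec i (\<psi> i) x) \<le> C i * indicator (cball 0 (R i)) x"
      by metis
    \<comment> \<open>The sums of the finitely many constants and radii serve as a common bound for
      all directions.\<close>
    have "norm (d x) \<le> (\<Sum>i\<in>UNIV. C i) * indicator (cball 0 (\<Sum>i\<in>UNIV. R i)) x" for x
    proof -
      have "norm (d x) \<le> (\<Sum>i\<in>UNIV. norm (pderiv_vec i (\<psi> i) x))"
        unfolding d_def by (rule norm_sum)
      also have "\<dots> \<le> (\<Sum>i\<in>UNIV. C i * indicator (cball 0 (\<Sum>i\<in>UNIV. R i)) x)"
      proof (rule sum_mono)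
        fix i
        have "R i \<le> (\<Sum>i\<in>UNIV. R i)"
          by (rule member_le_sum) (use CR(1) in \<open>auto intro: less_imp_le\<close>)
        then have "C i * indicator (cball 0 (R i)) x \<le> C i * indicator (cball 0 (\<Sum>i\<in>UNIV. R i)) x"
          using CR(1)[of i] by (intro mult_left_mono) (auto simp: indicator_def)
        then show "norm (pderiv_vec i (\<psi> i) x) \<le> C i * indicator (cball 0 (\<Sum>i\<in>UNIV. R i)) x"
          using CR(2)[of i x] by linarith
      qed
      finally show ?thesis by (simp add: sum_distrib_right)
    qed
    moreover have "0 < (\<Sum>i\<in>UNIV. C i)" "0 < (\<Sum>i\<in>UNIV. R i)"
      using CR(1) by (auto intro!: sum_pos)
    ultimately show ?thesis using that by blast
  qed
  \<comment> \<open>This integrand is read in two ways: integrating over s first produces the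
    difference of the dilated test functions, integrating over x first allows the weak gradient to
    act.\<close>
  define F where "F = (\<lambda>(s, x). indicator {1..2} s *\<^sub>R D s x *\<^sub>R u x)"
  have F: "integrable (lborel \<Otimes>\<^sub>M lborel) F"
  proof (rule integrable_pair_lborelI)
    show "F \<in> borel_measurable (lborel \<Otimes>\<^sub>M lborel)"
      unfolding F_def D_def by measurable
    let ?K = "\<integral>\<^sup>+x. ennreal (C * (indicator (cball 0 (2 * R)) x * norm (u x))) \<partial>lborel"
    show "?K < \<infinity>"
      by (rule nn_integral_bound_indicator_finite[OF L2_set_integrable[OF u]])
    show "(\<integral>\<^sup>+x. norm (F (s, x)) \<partial>lborel) \<le> ?K * indicator {1..2} s" for s
    proof (cases "s \<in> {1..2}")
      case True
      have "norm (F (s, x)) \<le> C * (indicator (cball 0 (2 * R)) x * norm (u x))" for x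
      proof -
        have "norm (D s x) \<le> 1 * norm (d ((1 / s) *\<^sub>R x))"
          unfolding D_def norm_minus_cancel norm_mult
          using True by (intro mult_right_mono) (auto simp: power_le_one_iff abs_mult simp del: power_Suc)
        also have "\<dots> \<le> C * indicator (cball 0 (2 * R)) x"
        proof -
          have "norm x \<le> 2 * R" if "norm x / s \<le> R"
          proof -
            have "norm x \<le> s * R" using that True by (simp add: field_simps)
            also have "\<dots> \<le> 2 * R" using True \<open>0 < R\<close> by (intro mult_right_mono) auto
            finally show ?thesis .
          qed
          then have "indicator (cball 0 R) ((1 / s) *\<^sub>R x) \<le> (indicator (cball 0 (2 * R)) x :: real)"
            using True by (auto simp: indicator_def)
          then have "C * indicator (cball 0 R) ((1 / s) *\<^sub>R x) \<le> C * indicator (cball 0 (2 * R)) x"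
            using \<open>0 < C\<close> by (intro mult_left_mono) auto
          then show ?thesis
            using C(3)[of "(1 / s) *\<^sub>R x"] by linarith
        qed
        finally have "norm (D s x) * norm (u x) \<le> C * indicator (cball 0 (2 * R)) x * norm (u x)"
          by (rule mult_right_mono) simp
        then show ?thesis using True by (simp add: F_def mult.assoc)
      qed
      then show ?thesis using True by (auto intro!: nn_integral_mono ennreal_leI)
    qed (simp add: F_def)
  qed
  have FTC: "(\<integral>s. F (s, x) \<partial>lborel) = ((1 / 2) ^ ?n * \<phi> ((1 / 2) *\<^sub>R x)) *\<^sub>R u x - \<phi> x *\<^sub>R u x" for x
  proof -
    have *: "continuous_on {1..2} (\<lambda>s. D s x)"
      unfolding D_def
      by (intro continuous_intros continuous_on_compose2[OF d]) auto
    have "(\<integral>s. indicator {1..2} s *\<^sub>R D s x \<partial>lborel) =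
       (1 / 2) ^ ?n * \<phi> ((1 / 2) *\<^sub>R x) - (1 / 1) ^ ?n * \<phi> ((1 / 1) *\<^sub>R x)"
      by (rule integral_FTC_Icc[OF _ _ *])
        (auto simp: D_def d_def \<psi>_def simp del: power_Suc intro!: dilation_has_vector_derivative[OF sm])
    moreover have "integrable lborel (\<lambda>s. indicator {1..2} s *\<^sub>R D s x)"
      using borel_integrable_compact[OF _ *] by (simp add: set_integrable_def)
    ultimately have "(\<integral>s. (indicator {1..2} s *\<^sub>R D s x) *\<^sub>R u x \<partial>lborel) =
       ((1 / 2) ^ ?n * \<phi> ((1 / 2) *\<^sub>R x) - \<phi> x) *\<^sub>R u x"
      by (subst integral_scaleR_left) simp_all
    then show ?thesis
      unfolding F_def by (simp add: scaleR_diff_left)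
  qed
  have \<phi>2: "(\<lambda>x. 1 * \<phi> ((1 / 2) *\<^sub>R x + 0)) \<in> test_functions"
    by (rule test_functions_affine[OF \<phi>]) simp
  have "(\<integral>x. \<phi> x *\<^sub>R u (2 *\<^sub>R x) \<partial>lborel) = ((1 / 2) ^ ?n) *\<^sub>R (\<integral>x. \<phi> ((1 / 2) *\<^sub>R x) *\<^sub>R u x \<partial>lborel)"
    using integral_lborel_affine[of "\<lambda>x. \<phi> ((1 / 2) *\<^sub>R x) *\<^sub>R u x" 2 0] by simp
  moreover have "integrable lborel (\<lambda>x. \<phi> x *\<^sub>R u (2 *\<^sub>R x))"
    using L2_test_mult[OF L2_affine(1)[OF u, of 2 1 0] \<phi>] by simp
  moreover have i2: "integrable lborel (\<lambda>x. \<phi> ((1 / 2) *\<^sub>R x) *\<^sub>R u x)"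
    using L2_test_mult[OF u \<phi>2] by simp
  moreover have "(\<integral>x. \<integral>s. F (s, x) \<partial>lborel \<partial>lborel) =
      (1 / 2) ^ ?n *\<^sub>R (\<integral>x. \<phi> ((1 / 2) *\<^sub>R x) *\<^sub>R u x \<partial>lborel) - (\<integral>x. \<phi> x *\<^sub>R u x \<partial>lborel)"
    unfolding FTC scaleR_scaleR[symmetric]
    by (subst Bochner_Integration.integral_diff) (use i2 L2_test_mult[OF u \<phi>] in \<open>auto simp del: scaleR_scaleR\<close>)
  ultimately have "(\<integral>x. \<phi> x *\<^sub>R (u (2 *\<^sub>R x) - u x) \<partial>lborel) = (\<integral>x. \<integral>s. F (s, x) \<partial>lborel \<partial>lborel)"
    using L2_test_mult[OF u \<phi>] by (simp add: scaleR_diff_right)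
  also have "\<dots> = (\<integral>s. \<integral>x. F (s, x) \<partial>lborel \<partial>lborel)"
    by (rule lborel_pair.Fubini_integral) (use F in simp)
  also have "\<dots> = (\<integral>s. indicator {1..2} s *\<^sub>R (\<integral>x. \<phi> x *\<^sub>R (\<Sum>i\<in>UNIV. x $ i *\<^sub>R g (s *\<^sub>R x) $ i) \<partial>lborel) \<partial>lborel)"
  proof (rule Bochner_Integration.integral_cong[OF refl])
    fix s :: real
    show "(\<integral>x. F (s, x) \<partial>lborel) =
       indicator {1..2} s *\<^sub>R (\<integral>x. \<phi> x *\<^sub>R (\<Sum>i\<in>UNIV. x $ i *\<^sub>R g (s *\<^sub>R x) $ i) \<partial>lborel)"
    proof (cases "s \<in> {1..2}")
      case True
      then have s: "s > 0" by simp
      \<comment> \<open>Differentiating after the dilation costs a factor 1 / s, which accounts for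
        one of the N + 1 powers in \<open>D\<close>. The remaining N powers are the Jacobian that
        restores the original scale.\<close>
      define \<psi>s where "\<psi>s i = (\<lambda>x. 1 * \<psi> i ((1 / s) *\<^sub>R x + 0))" for i
      have \<psi>s: "\<psi>s i \<in> test_functions" for i
        unfolding \<psi>s_def using s by (intro test_functions_affine \<psi>) simp
      have d\<psi>s: "pderiv_vec i (\<psi> i) ((1 / s) *\<^sub>R x) = s * pderiv_vec i (\<psi>s i) x" for i x
        unfolding \<psi>s_def using s \<psi>
        by (subst pderiv_vec_affine) (auto simp: smooth_differentiable test_functions_iff)
      have "(\<integral>x. F (s, x) \<partial>lborel) = (\<integral>x. (- ((1 / s) ^ ?n)) *\<^sub>R (\<Sum>i\<in>UNIV. pderiv_vec i (\<psi>s i) x *\<^sub>R u x) \<partial>lborel)"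
        using True by (intro Bochner_Integration.integral_cong refl)
          (simp add: F_def D_def d_def d\<psi>s sum_distrib_left[symmetric] scaleR_sum_left[symmetric])
      also have "\<dots> = (- ((1 / s) ^ ?n)) *\<^sub>R (\<Sum>i\<in>UNIV. \<integral>x. pderiv_vec i (\<psi>s i) x *\<^sub>R u x \<partial>lborel)"
        unfolding integral_scaleR_right
        by (subst Bochner_Integration.integral_sum) (auto intro!: L2_test_mult u test_functions_pderiv_vec \<psi>s)
      also have "\<dots> = (\<Sum>i\<in>UNIV. ((1 / s) ^ ?n) *\<^sub>R \<integral>x. \<psi>s i x *\<^sub>R g x $ i \<partial>lborel)"
        using w \<psi>s by (simp add: is_weak_gradient_def sum_negf scaleR_sum_right)
      also have "\<dots> = (\<Sum>i\<in>UNIV. \<integral>x. \<psi> i x *\<^sub>R g (s *\<^sub>R x) $ i \<partial>lborel)"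
      proof (rule sum.cong[OF refl])
        fix i
        have [measurable]: "\<psi> i \<in> borel_measurable borel" by (rule test_function_measurable[OF \<psi>])
        show "((1 / s) ^ ?n) *\<^sub>R (\<integral>x. \<psi>s i x *\<^sub>R g x $ i \<partial>lborel) = (\<integral>x. \<psi> i x *\<^sub>R g (s *\<^sub>R x) $ i \<partial>lborel)"
          using integral_lborel_affine[of "\<lambda>x. \<psi>s i x *\<^sub>R g x $ i" s 0] s by (simp add: \<psi>s_def)
      qed
      also have "\<dots> = (\<integral>x. (\<Sum>i\<in>UNIV. \<psi> i x *\<^sub>R g (s *\<^sub>R x) $ i) \<partial>lborel)"
      proof (rule Bochner_Integration.integral_sum[symmetric])
        fix i
        have "(\<lambda>x. 1 *\<^sub>R g (s *\<^sub>R x + 0)) \<in> L2" by (rule L2_affine(1)[OF g s])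
        from L2_test_mult[OF L2_component[OF this] \<psi>, of i i]
        show "integrable lborel (\<lambda>x. \<psi> i x *\<^sub>R g (s *\<^sub>R x) $ i)" by simp
      qed
      also have "\<dots> = (\<integral>x. \<phi> x *\<^sub>R (\<Sum>i\<in>UNIV. x $ i *\<^sub>R g (s *\<^sub>R x) $ i) \<partial>lborel)"
        by (simp add: \<psi>_def scaleR_sum_right mult.commute)
      finally show ?thesis using True by simp
    qed (simp add: F_def)
  qed
  finally show ?thesis .
qed

text \<open>Fubini turns the tested identity into equality of the test integrals of two locally
  integrable functions, which then agree almost everywhere.\<close>

lemma dilation_difference:
  fixes u :: "real^'n::finite \<Rightarrow> complex"
  assumes u: "u \<in> L2" and g: "g \<in> L2" and w: "is_weak_gradient u g"
  shows "AE x in lborel. u (2 *\<^sub>R x) - u x =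
     (\<integral>s. indicator {1..2} s *\<^sub>R (\<Sum>i\<in>UNIV. x $ i *\<^sub>R g (s *\<^sub>R x) $ i) \<partial>lborel)"
proof -
  have [measurable]: "g \<in> borel_measurable borel" "u \<in> borel_measurable borel"
    using L2_measurable[OF u] L2_measurable[OF g] by auto
  define W where "W = (\<lambda>x. \<integral>s. indicator {1..2::real} s *\<^sub>R (\<Sum>i\<in>UNIV. x $ i *\<^sub>R g (s *\<^sub>R x) $ i) \<partial>lborel)"
  have W[measurable]: "W \<in> borel_measurable borel"
    unfolding W_def by measurable
  \<comment> \<open>Stated for bounded measurable \<open>\<theta>\<close> with bounded support,
    since it is used twice: with the indicator of a ball for the local integrability of
    \<open>W\<close>, and with a test function for the identity itself.\<close>
  have pair: "integrable lborel (\<lambda>x. \<theta> x *\<^sub>R W x)"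
     "(\<integral>s. indicator {1..2} s *\<^sub>R (\<integral>x. \<theta> x *\<^sub>R (\<Sum>i\<in>UNIV. x $ i *\<^sub>R g (s *\<^sub>R x) $ i) \<partial>lborel) \<partial>lborel) =
        (\<integral>x. \<theta> x *\<^sub>R W x \<partial>lborel)"
    if \<theta>: "\<theta> \<in> borel_measurable borel" "\<And>x. norm (\<theta> x) \<le> C * indicator (cball 0 R) x" "0 < C" "0 < R" for \<theta> C R
  proof -
    let ?F = "\<lambda>(s::real) x. indicator {1..2} s *\<^sub>R \<theta> x *\<^sub>R (\<Sum>i\<in>UNIV. x $ i *\<^sub>R g (s *\<^sub>R x) $ i)"
    have F: "integrable (lborel \<Otimes>\<^sub>M lborel) (case_prod ?F)"
      using integrable_dilated_pairing[OF g \<theta>] by simp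
    have eq: "(\<integral>s. ?F s x \<partial>lborel) = \<theta> x *\<^sub>R W x" for x
      unfolding W_def integral_scaleR_right[symmetric] by (simp add: mult.commute)
    show "integrable lborel (\<lambda>x. \<theta> x *\<^sub>R W x)"
      using lborel_pair.integrable_snd[OF F] unfolding eq .
    show "(\<integral>s. indicator {1..2} s *\<^sub>R (\<integral>x. \<theta> x *\<^sub>R (\<Sum>i\<in>UNIV. x $ i *\<^sub>R g (s *\<^sub>R x) $ i) \<partial>lborel) \<partial>lborel) =
        (\<integral>x. \<theta> x *\<^sub>R W x \<partial>lborel)"
      using lborel_pair.Fubini_integral[OF F] unfolding eq integral_scaleR_right by simp
  qed
  have "AE x in lborel. u (2 *\<^sub>R x) - u x - W x = 0"
  proof (rule AE_zero_if_test_integrals_zero)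
    have u2: "(\<lambda>x. u (2 *\<^sub>R x)) \<in> L2" using L2_affine(1)[OF u, of 2 1 0] by simp
    show "(\<lambda>x. u (2 *\<^sub>R x) - u x - W x) \<in> borel_measurable borel" by measurable
    show "set_integrable lborel (cball 0 R) (\<lambda>x. u (2 *\<^sub>R x) - u x - W x)" for R
    proof -
      \<comment> \<open>The maximum with 1 provides a positive radius also when \<open>R\<close> is
        not positive.\<close>
      have "set_integrable lborel (cball 0 (max R 1)) W"
        unfolding set_integrable_def
        by (rule pair(1)[of _ 1 "max R 1"]) (auto intro!: borel_measurable_indicator)
      then have "set_integrable lborel (cball 0 R) W"
        by (rule set_integrable_subset) auto
      then show ?thesis
        using set_integral_diff(1)[OF set_integral_diff(1)[OF L2_set_integrable[OF u2] L2_set_integrable[OF u]]] by blast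
    qed
    show "(\<integral>x. \<phi> x *\<^sub>R (u (2 *\<^sub>R x) - u x - W x) \<partial>lborel) = 0" if \<phi>: "\<phi> \<in> test_functions" for \<phi>
    proof -
      obtain C R where C: "0 < C" "0 < R" "\<And>x. norm (\<phi> x) \<le> C * indicator (cball 0 R) x"
        using test_function_bound[OF \<phi>] by blast
      note p = pair[OF test_function_measurable[OF \<phi>] C(3,1,2)]
      have "integrable lborel (\<lambda>x. \<phi> x *\<^sub>R (u (2 *\<^sub>R x) - u x))"
        unfolding scaleR_diff_right by (intro Bochner_Integration.integrable_diff L2_test_mult u u2 \<phi>)
      then have "(\<integral>x. \<phi> x *\<^sub>R (u (2 *\<^sub>R x) - u x - W x) \<partial>lborel) =
          (\<integral>x. \<phi> x *\<^sub>R (u (2 *\<^sub>R x) - u x) \<partial>lborel) - (\<integral>x. \<phi> x *\<^sub>R W x \<partial>lborel)"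
        using p(1) unfolding scaleR_diff_right[of _ _ "W _"] by (rule Bochner_Integration.integral_diff)
      then show ?thesis
        using dilation_difference_tested[OF u g w \<phi>] p(2) by simp
    qed
  qed
  then show ?thesis unfolding W_def by eventually_elim simp
qed

section \<open>Bounds for the Riesz energy\<close>

text \<open>Jensen's inequality on an interval of length 1, obtained from Cauchy-Schwarz.
  Integrability of \<open>f\<close> is not assumed: a Bochner integral that does not exist is 0, and
  the bound is then trivial.\<close>

lemma norm_integral_unit_interval_le:
  fixes f :: "real \<Rightarrow> 'b::{banach, second_countable_topology}"
  assumes [measurable]: "f \<in> borel_measurable borel"
  shows "ennreal ((norm (\<integral>s. indicator {1..2} s *\<^sub>R f s \<partial>lborel))\<^sup>2) \<le>
    (\<integral>\<^sup>+s. ennreal ((norm (f s))\<^sup>2) * indicator {1..2} s \<partial>lborel)"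
proof -
  let ?f = "\<lambda>s. indicator {1..2} s *\<^sub>R f s"
  have "ennreal (norm (\<integral>s. ?f s \<partial>lborel)) \<le> (\<integral>\<^sup>+s. ennreal (norm (?f s)) \<partial>lborel)"
    using integral_norm_bound_ennreal[of lborel ?f]
    by (cases "integrable lborel ?f") (auto simp: not_integrable_integral_eq)
  also have "\<dots> = (\<integral>\<^sup>+s. ennreal (norm (?f s)) * indicator {1..2} s \<partial>lborel)"
    by (intro nn_integral_cong) (auto simp: indicator_def)
  finally have "(ennreal (norm (\<integral>s. ?f s \<partial>lborel)))\<^sup>2 \<le> (\<integral>\<^sup>+s. ennreal (norm (?f s)) * indicator {1..2} s \<partial>lborel)\<^sup>2"
    by (rule power_mono) simp
  also have "\<dots> \<le> (\<integral>\<^sup>+s. (ennreal (norm (?f s)))\<^sup>2 \<partial>lborel) * (\<integral>\<^sup>+s. (indicator {1..2::real} s)\<^sup>2 \<partial>lborel)"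
    by (rule Cauchy_Schwarz_nn_integral) measurable
  also have "(\<integral>\<^sup>+s. (indicator {1..2::real} s)\<^sup>2 \<partial>lborel) = (\<integral>\<^sup>+s. indicator {1..2::real} s \<partial>lborel)"
    by (intro nn_integral_cong) (auto simp: indicator_def)
  also have "\<dots> = 1" by simp
  also have "(\<integral>\<^sup>+s. (ennreal (norm (?f s)))\<^sup>2 \<partial>lborel) = (\<integral>\<^sup>+s. ennreal ((norm (f s))\<^sup>2) * indicator {1..2} s \<partial>lborel)"
    by (intro nn_integral_cong) (auto simp: indicator_def ennreal_power)
  finally show ?thesis by (simp add: ennreal_power)
qed

text \<open>The triangle inequality produces a cross term; adding the nonnegative square of \<eta>
  |b| - |b - a|, divided by \<eta>, cancels it. A small \<eta> keeps the factor of |b| squared so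
  close to 1 that the contraction gained by dilation survives.\<close>

lemma norm_square_le_weighted:
  fixes a b :: "'a::real_normed_vector"
  assumes "\<eta> > 0"
  shows "(norm a)\<^sup>2 \<le> (1 + \<eta>) * (norm b)\<^sup>2 + (1 + 1 / \<eta>) * (norm (b - a))\<^sup>2"
proof -
  have "norm a \<le> norm b + norm (b - a)"
    using norm_triangle_ineq4[of b "b - a"] by simp
  then have "(norm a)\<^sup>2 \<le> (norm b + norm (b - a))\<^sup>2" by (intro power_mono) auto
  also have "\<dots> \<le> (norm b + norm (b - a))\<^sup>2 + (\<eta> * norm b - norm (b - a))\<^sup>2 / \<eta>" using assms by simp
  also have "\<dots> = (1 + \<eta>) * (norm b)\<^sup>2 + (1 + 1 / \<eta>) * (norm (b - a))\<^sup>2"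
    using assms by (simp add: power2_eq_square field_simps)
  finally show ?thesis .
qed

text \<open>Jensen and Cauchy-Schwarz bound the squared difference by the square of |x| times the
  mean of the squared norm of g(s x). The weight absorbs the square of |x|, and integrating g(s x)
  over x gains a Jacobian of at most 1.\<close>

lemma dilation_difference_weighted:
  fixes u :: "real^'n::finite \<Rightarrow> complex"
  assumes u: "u \<in> L2" and g: "g \<in> L2" and w: "is_weak_gradient u g" and "0 \<le> B"
    and A[measurable]: "A \<in> sets borel"
    and [measurable]: "k \<in> borel_measurable borel" and k: "\<And>x. x \<in> A \<Longrightarrow> 0 \<le> k x \<and> k x * (norm x)\<^sup>2 \<le> B"
  shows "(\<integral>\<^sup>+x. ennreal ((norm (u (2 *\<^sub>R x) - u x))\<^sup>2 * k x) * indicator A x \<partial>lborel) \<le>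
    ennreal (B * (\<integral>x. (norm (g x))\<^sup>2 \<partial>lborel))"
proof -
  have [measurable]: "g \<in> borel_measurable borel" "u \<in> borel_measurable borel"
    using L2_measurable[OF u] L2_measurable[OF g] by auto
  let ?H = "\<lambda>x. \<integral>\<^sup>+s. ennreal ((norm (g (s *\<^sub>R x)))\<^sup>2) * indicator {1..2::real} s \<partial>lborel"
  let ?G = "\<integral>\<^sup>+x. ennreal ((norm (g x))\<^sup>2) \<partial>lborel"
  have "(\<integral>\<^sup>+x. ennreal ((norm (u (2 *\<^sub>R x) - u x))\<^sup>2 * k x) * indicator A x \<partial>lborel) \<le> (\<integral>\<^sup>+x. ennreal B * ?H x \<partial>lborel)"
  proof (rule nn_integral_mono_AE)
    show "AE x in lborel. ennreal ((norm (u (2 *\<^sub>R x) - u x))\<^sup>2 * k x) * indicator A x \<le> ennreal B * ?H x"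
      using dilation_difference[OF u g w]
    proof eventually_elim
      case (elim x)
      show ?case
      proof (cases "x \<in> A")
        case True
        have "ennreal ((norm (u (2 *\<^sub>R x) - u x))\<^sup>2) \<le>
           (\<integral>\<^sup>+s. ennreal ((norm (\<Sum>i\<in>UNIV. x $ i *\<^sub>R g (s *\<^sub>R x) $ i))\<^sup>2) * indicator {1..2} s \<partial>lborel)"
          unfolding elim by (rule norm_integral_unit_interval_le) measurable
        also have "\<dots> \<le> (\<integral>\<^sup>+s. ennreal ((norm x)\<^sup>2) * (ennreal ((norm (g (s *\<^sub>R x)))\<^sup>2) * indicator {1..2} s) \<partial>lborel)"
          by (intro nn_integral_mono)
            (auto simp: indicator_def ennreal_mult[symmetric] power_mult_distrib[symmetric]
              intro!: ennreal_leI power_mono norm_sum_scaleR_vec_le)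
        also have "\<dots> = ennreal ((norm x)\<^sup>2) * ?H x"
          by (rule nn_integral_cmult) measurable
        finally have "ennreal (k x) * ennreal ((norm (u (2 *\<^sub>R x) - u x))\<^sup>2) \<le> ennreal (k x) * (ennreal ((norm x)\<^sup>2) * ?H x)"
          by (rule mult_left_mono) simp
        also have "\<dots> = ennreal (k x * (norm x)\<^sup>2) * ?H x"
          using k[OF True] by (simp add: ennreal_mult mult.assoc)
        also have "\<dots> \<le> ennreal B * ?H x"
          using k[OF True] by (intro mult_right_mono ennreal_leI) auto
        finally show ?thesis using True k[OF True] by (simp add: ennreal_mult mult.commute)
      qed simp
    qed
  qed
  also have "\<dots> = ennreal B * (\<integral>\<^sup>+x. ?H x \<partial>lborel)"
    by (rule nn_integral_cmult) measurable
  also have "(\<integral>\<^sup>+x. ?H x \<partial>lborel) = (\<integral>\<^sup>+s. \<integral>\<^sup>+x. ennreal ((norm (g (s *\<^sub>R x)))\<^sup>2) * indicator {1..2::real} s \<partial>lborel \<partial>lborel)"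
    by (rule lborel_pair.Fubini') measurable
  also have "\<dots> \<le> (\<integral>\<^sup>+s. ?G * indicator {1..2::real} s \<partial>lborel)"
  proof (rule nn_integral_mono)
    fix s :: real
    show "(\<integral>\<^sup>+x. ennreal ((norm (g (s *\<^sub>R x)))\<^sup>2) * indicator {1..2} s \<partial>lborel) \<le> ?G * indicator {1..2} s"
    proof (cases "s \<in> {1..2}")
      case True
      have "(\<integral>\<^sup>+x. ennreal ((norm (g (s *\<^sub>R x)))\<^sup>2) \<partial>lborel) = ennreal ((1 / s) ^ CARD('n)) * ?G"
        using nn_integral_lborel_affine[of "\<lambda>x. ennreal ((norm (g x))\<^sup>2)" s 0] True by simp
      also have "\<dots> \<le> 1 * ?G"
        using True by (intro mult_right_mono) (auto intro!: power_le_one simp: power_one_over)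
      finally show ?thesis using True by simp
    qed simp
  qed
  also have "(\<integral>\<^sup>+s. ?G * indicator {1..2::real} s \<partial>lborel) = ?G"
    by (subst nn_integral_cmult_indicator) auto
  also have "?G = ennreal (\<integral>x. (norm (g x))\<^sup>2 \<partial>lborel)"
    using g by (intro nn_integral_eq_integral) (auto simp: L2_def)
  also have "ennreal B * ennreal (\<integral>x. (norm (g x))\<^sup>2 \<partial>lborel) = ennreal (B * (\<integral>x. (norm (g x))\<^sup>2 \<partial>lborel))"
    using \<open>0 \<le> B\<close> by (simp add: ennreal_mult)
  finally show ?thesis by (simp add: mult_left_mono)
qed

text \<open>Comparing \<open>u(x)\<close> with \<open>u(2 x)\<close> contracts the weighted norm by \<open>2 powr (\<gamma> - N) < 1\<close>, so that
  the weighted norm can be absorbed; the cut-off \<open>\<rho>\<close> makes it finite beforehand.\<close>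
lemma weighted_mass_annulus_le:
  fixes u :: "real^'n::finite \<Rightarrow> complex" and \<gamma> :: real
  assumes u: "u \<in> L2" and g: "g \<in> L2" and w: "is_weak_gradient u g"
    and \<gamma>: "0 < \<gamma>" "\<gamma> < 2" and "0 < \<rho>" "\<rho> < \<delta>" "0 < \<eta>"
    and q: "q = (1 + \<eta>) * 2 powr (\<gamma> - CARD('n))" "q < 1"
  shows "(\<integral>\<^sup>+x. ennreal ((norm (u x))\<^sup>2 * norm x powr - \<gamma>) * indicator {x. \<rho> < norm x \<and> norm x \<le> \<delta>} x \<partial>lborel)
    \<le> ennreal ((q * (\<delta> powr - \<gamma> * (\<integral>x. (norm (u x))\<^sup>2 \<partial>lborel)) + (1 + 1 / \<eta>) * (\<delta> powr (2 - \<gamma>) * (\<integral>x. (norm (g x))\<^sup>2 \<partial>lborel))) / (1 - q))"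
proof -
  note [measurable] = L2_measurable[OF u]
  define m where "m = (\<integral>x. (norm (u x))\<^sup>2 \<partial>lborel)"
  define G where "G = (\<integral>x. (norm (g x))\<^sup>2 \<partial>lborel)"
  have m: "(\<integral>\<^sup>+x. ennreal ((norm (u x))\<^sup>2) \<partial>lborel) = ennreal m"
    unfolding m_def using u by (intro nn_integral_eq_integral) (auto simp: L2_def)
  have nonneg: "0 \<le> m" "0 \<le> G" by (auto simp: m_def G_def)
  define A where "A = {x::real^'n. \<rho> < norm x \<and> norm x \<le> \<delta>}"
  \<comment> \<open>The substitution y = 2 x sends the annulus \<open>A\<close> into this larger
    one.\<close>
  define A' where "A' = {x::real^'n. \<rho> < norm x \<and> norm x \<le> 2 * \<delta>}"
  have [measurable]: "A \<in> sets borel" "A' \<in> sets borel"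
    unfolding A_def A'_def by measurable
  let ?f = "\<lambda>x. (norm (u x))\<^sup>2 * norm x powr - \<gamma>"
  define F where "F = (\<integral>\<^sup>+x. ennreal (?f x) * indicator A x \<partial>lborel)"
  have powr_le: "norm x powr - \<gamma> \<le> r powr - \<gamma>" if "0 < r" "r \<le> norm x" for r and x :: "real^'n"
    using that \<gamma> by (intro powr_mono2') auto
  have "F \<le> (\<integral>\<^sup>+x. ennreal (\<rho> powr - \<gamma>) * ennreal ((norm (u x))\<^sup>2) \<partial>lborel)"
    unfolding F_def
  proof (rule nn_integral_mono)
    fix x
    show "ennreal (?f x) * indicator A x \<le> ennreal (\<rho> powr - \<gamma>) * ennreal ((norm (u x))\<^sup>2)"
      using powr_le[of \<rho> x] \<open>0 < \<rho>\<close>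
      by (auto simp: A_def indicator_def ennreal_mult[symmetric] mult.commute intro!: ennreal_leI mult_right_mono)
  qed
  also have "\<dots> = ennreal (\<rho> powr - \<gamma> * m)"
    using nonneg by (simp add: nn_integral_cmult m ennreal_mult)
  \<comment> \<open>Finiteness is what will permit subtracting \<open>q * F\<close> from both sides;
    it holds because the weight is bounded away from the origin.\<close>
  finally have "F < \<infinity>" by (metis ennreal_less_top infinity_ennreal_def order_le_less_trans)
  then obtain Fr where Fr: "F = ennreal Fr" "0 \<le> Fr" by (cases F) auto
  have "F \<le> (\<integral>\<^sup>+x. ennreal (1 + \<eta>) * (ennreal ((norm (u (2 *\<^sub>R x)))\<^sup>2 * norm x powr - \<gamma>) * indicator A x)
      + ennreal (1 + 1 / \<eta>) * (ennreal ((norm (u (2 *\<^sub>R x) - u x))\<^sup>2 * norm x powr - \<gamma>) * indicator A x) \<partial>lborel)"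
    unfolding F_def
  proof (rule nn_integral_mono)
    fix x
    have "?f x \<le> ((1 + \<eta>) * (norm (u (2 *\<^sub>R x)))\<^sup>2 + (1 + 1 / \<eta>) * (norm (u (2 *\<^sub>R x) - u x))\<^sup>2) * norm x powr - \<gamma>"
      by (intro mult_right_mono norm_square_le_weighted \<open>0 < \<eta>\<close>) auto
    then show "ennreal (?f x) * indicator A x \<le> ennreal (1 + \<eta>) * (ennreal ((norm (u (2 *\<^sub>R x)))\<^sup>2 * norm x powr - \<gamma>) * indicator A x)
      + ennreal (1 + 1 / \<eta>) * (ennreal ((norm (u (2 *\<^sub>R x) - u x))\<^sup>2 * norm x powr - \<gamma>) * indicator A x)"
      using \<open>0 < \<eta>\<close>
      by (auto simp: indicator_def ennreal_mult[symmetric] ennreal_plus[symmetric] algebra_simps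
          simp del: ennreal_plus intro!: ennreal_leI)
  qed
  also have "\<dots> = ennreal (1 + \<eta>) * (\<integral>\<^sup>+x. ennreal ((norm (u (2 *\<^sub>R x)))\<^sup>2 * norm x powr - \<gamma>) * indicator A x \<partial>lborel)
      + ennreal (1 + 1 / \<eta>) * (\<integral>\<^sup>+x. ennreal ((norm (u (2 *\<^sub>R x) - u x))\<^sup>2 * norm x powr - \<gamma>) * indicator A x \<partial>lborel)"
    by (simp add: nn_integral_add nn_integral_cmult)
  also have "(\<integral>\<^sup>+x. ennreal ((norm (u (2 *\<^sub>R x) - u x))\<^sup>2 * norm x powr - \<gamma>) * indicator A x \<partial>lborel) \<le>
      ennreal (\<delta> powr (2 - \<gamma>) * G)"
    unfolding G_def
  proof (rule dilation_difference_weighted[OF u g w])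
    fix x assume "x \<in> A"
    then have x: "0 < norm x" "norm x \<le> \<delta>" using \<open>0 < \<rho>\<close> by (auto simp: A_def)
    then have "norm x powr - \<gamma> * (norm x)\<^sup>2 = norm x powr (2 - \<gamma>)"
      by (simp add: powr_add[of _ 2 "- \<gamma>", simplified] flip: powr_numeral)
    also have "\<dots> \<le> \<delta> powr (2 - \<gamma>)" using x \<gamma> by (intro powr_mono2) auto
    finally show "0 \<le> norm x powr - \<gamma> \<and> norm x powr - \<gamma> * (norm x)\<^sup>2 \<le> \<delta> powr (2 - \<gamma>)" by simp
  qed auto
  also have "(\<integral>\<^sup>+x. ennreal ((norm (u (2 *\<^sub>R x)))\<^sup>2 * norm x powr - \<gamma>) * indicator A x \<partial>lborel) \<le>
     ennreal (2 powr (\<gamma> - CARD('n))) * (F + ennreal (\<delta> powr - \<gamma> * m))"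
  proof -
    have "(\<integral>\<^sup>+x. ennreal ((norm (u (2 *\<^sub>R x)))\<^sup>2 * norm x powr - \<gamma>) * indicator A x \<partial>lborel) \<le>
       (\<integral>\<^sup>+x. ennreal (2 powr \<gamma>) * (ennreal (?f (2 *\<^sub>R x + 0)) * indicator A' (2 *\<^sub>R x + 0)) \<partial>lborel)"
    proof (rule nn_integral_mono)
      fix x :: "real^'n"
      \<comment> \<open>Homogeneity of the weight costs \<open>2 powr \<gamma>\<close>, while the
        Jacobian of y = 2 x gains 2 to the power -N. Their product is the contraction
        factor.\<close>
      have "norm x powr - \<gamma> = 2 powr \<gamma> * norm (2 *\<^sub>R x) powr - \<gamma>"
        by (simp add: powr_mult powr_minus)
      then show "ennreal ((norm (u (2 *\<^sub>R x)))\<^sup>2 * norm x powr - \<gamma>) * indicator A x \<le>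
         ennreal (2 powr \<gamma>) * (ennreal (?f (2 *\<^sub>R x + 0)) * indicator A' (2 *\<^sub>R x + 0))"
        using \<open>0 < \<rho>\<close> by (auto simp: indicator_def A_def A'_def ennreal_mult[symmetric] mult_ac)
    qed
    also have "\<dots> = ennreal (2 powr \<gamma>) * (\<integral>\<^sup>+x. ennreal (?f (2 *\<^sub>R x + 0)) * indicator A' (2 *\<^sub>R x + 0) \<partial>lborel)"
      by (rule nn_integral_cmult) measurable
    also have "(\<integral>\<^sup>+x. ennreal (?f (2 *\<^sub>R x + 0)) * indicator A' (2 *\<^sub>R x + 0) \<partial>lborel) =
       ennreal ((1 / 2) ^ CARD('n)) * (\<integral>\<^sup>+x. ennreal (?f x) * indicator A' x \<partial>lborel)"
      by (rule nn_integral_lborel_affine[where f="\<lambda>x. ennreal (?f x) * indicator A' x"]) auto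
    also have "ennreal (2 powr \<gamma>) * (ennreal ((1 / 2) ^ CARD('n)) * (\<integral>\<^sup>+x. ennreal (?f x) * indicator A' x \<partial>lborel)) =
      ennreal (2 powr (\<gamma> - CARD('n))) * (\<integral>\<^sup>+x. ennreal (?f x) * indicator A' x \<partial>lborel)"
    proof -
      have "2 powr (\<gamma> - CARD('n)) = 2 powr \<gamma> * (1 / 2) ^ CARD('n)"
        by (simp add: powr_diff powr_realpow power_one_over)
      then have "ennreal (2 powr (\<gamma> - CARD('n))) = ennreal (2 powr \<gamma>) * ennreal ((1 / 2) ^ CARD('n))"
        by (simp only: ennreal_mult powr_ge_zero zero_le_power divide_nonneg_nonneg zero_le_one zero_le_numeral)
      then show ?thesis by (simp only: mult.assoc)
    qed
    also have "(\<integral>\<^sup>+x. ennreal (?f x) * indicator A' x \<partial>lborel) \<le>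
       (\<integral>\<^sup>+x. ennreal (?f x) * indicator A x + ennreal (\<delta> powr - \<gamma>) * ennreal ((norm (u x))\<^sup>2) \<partial>lborel)"
    proof (rule nn_integral_mono)
      fix x
      show "ennreal (?f x) * indicator A' x \<le> ennreal (?f x) * indicator A x + ennreal (\<delta> powr - \<gamma>) * ennreal ((norm (u x))\<^sup>2)"
      \<comment> \<open>Inside the ball of radius \<delta> the annuli \<open>A'\<close> and
        \<open>A\<close> coincide. On the rest of \<open>A'\<close> the weight is at most
        \<open>\<delta> powr - \<gamma>\<close>, so the mass controls that part.\<close>
      proof (cases "norm x \<le> \<delta>")
        case True
        then show ?thesis by (auto simp: indicator_def A_def A'_def)
      next
        case False
        then have "?f x \<le> \<delta> powr - \<gamma> * (norm (u x))\<^sup>2"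
          using powr_le[of \<delta> x] \<open>0 < \<rho>\<close> \<open>\<rho> < \<delta>\<close> by (subst mult.commute) (intro mult_right_mono, auto)
        then show ?thesis using False
          by (auto simp: indicator_def A_def ennreal_mult[symmetric] intro!: ennreal_leI)
      qed
    qed
    also have "\<dots> = F + ennreal (\<delta> powr - \<gamma> * m)"
      using nonneg by (simp add: nn_integral_add nn_integral_cmult F_def m ennreal_mult)
    finally show ?thesis by (simp add: mult_left_mono)
  qed
  finally have "F \<le> ennreal (1 + \<eta>) * (ennreal (2 powr (\<gamma> - CARD('n))) * (F + ennreal (\<delta> powr - \<gamma> * m)))
      + ennreal (1 + 1 / \<eta>) * ennreal (\<delta> powr (2 - \<gamma>) * G)"
    by (simp add: mult_left_mono add_mono)
  then have "ennreal Fr \<le> ennreal (q * (Fr + \<delta> powr - \<gamma> * m) + (1 + 1 / \<eta>) * (\<delta> powr (2 - \<gamma>) * G))"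
    using \<open>0 < \<eta>\<close> nonneg Fr(2) unfolding Fr(1) q(1)
    by (simp add: ennreal_mult[symmetric] ennreal_plus[symmetric] mult.assoc del: ennreal_plus)
  moreover have "0 \<le> q" using \<open>0 < \<eta>\<close> by (simp add: q(1))
  ultimately have "Fr \<le> q * (Fr + \<delta> powr - \<gamma> * m) + (1 + 1 / \<eta>) * (\<delta> powr (2 - \<gamma>) * G)"
    using nonneg Fr(2) \<open>0 < \<eta>\<close> by (subst (asm) ennreal_le_iff) auto
  \<comment> \<open>The absorption: the unknown occurs on the right with a factor below 1. The
    resulting bound no longer depends on the inner radius \<rho>.\<close>
  then have "Fr * (1 - q) \<le> q * (\<delta> powr - \<gamma> * m) + (1 + 1 / \<eta>) * (\<delta> powr (2 - \<gamma>) * G)"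
    by (simp add: algebra_simps)
  then have "Fr \<le> (q * (\<delta> powr - \<gamma> * m) + (1 + 1 / \<eta>) * (\<delta> powr (2 - \<gamma>) * G)) / (1 - q)"
    using q(2) by (simp add: pos_le_divide_eq)
  then show ?thesis
    using Fr(1) unfolding F_def A_def m_def G_def by (simp add: ennreal_leI)
qed

text \<open>As the inner radius tends to 0, Fatou's lemma carries the annulus bound to the punctured
  ball; outside the ball the weight is at most \<open>\<delta> powr - \<gamma>\<close>. The radius
  \<delta> stays free so that the coefficient \<open>\<delta> powr (2 - \<gamma>)\<close> of the
  gradient term can be made small, and \<open>K\<close> is independent of the state.\<close>

lemma weighted_mass_le:
  fixes \<gamma> :: real
  assumes \<gamma>: "0 < \<gamma>" "\<gamma> < 2" "\<gamma> < CARD('n::finite)"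
  obtains K where "0 < K"
    "\<And>(u :: real^'n \<Rightarrow> complex) g \<delta>. u \<in> L2 \<Longrightarrow> g \<in> L2 \<Longrightarrow> is_weak_gradient u g \<Longrightarrow> 0 < \<delta> \<Longrightarrow>
      (\<integral>\<^sup>+x. ennreal ((norm (u x))\<^sup>2 * norm x powr - \<gamma>) \<partial>lborel) \<le>
      ennreal (K * (\<delta> powr - \<gamma> * (\<integral>x. (norm (u x))\<^sup>2 \<partial>lborel) + \<delta> powr (2 - \<gamma>) * (\<integral>x. (norm (g x))\<^sup>2 \<partial>lborel)))"
proof -
  define r where "r = 2 powr (\<gamma> - CARD('n))"
  \<comment> \<open>Chosen so that 1 - (1 + \<eta>) r equals (1 - r) (2 - r) / 2, which is
    positive.\<close>
  define \<eta> where "\<eta> = (1 - r) / 2"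
  define q where "q = (1 + \<eta>) * 2 powr (\<gamma> - CARD('n))"
  have r: "0 < r" "r < 1" using powr_less_mono[of "\<gamma> - CARD('n)" 0 2] \<gamma> by (auto simp: r_def)
  then have \<eta>: "0 < \<eta>" by (simp add: \<eta>_def)
  have "0 < (1 - r) * (2 - r)" using r by simp
  then have "(1 + \<eta>) * r < 1" by (simp add: \<eta>_def field_simps)
  then have q: "0 < q" "q < 1" using r \<eta> by (auto simp: q_def r_def[symmetric])
  \<comment> \<open>The first summand comes from the absorbed annulus bound, the final 1 from the
    exterior of the ball.\<close>
  define K where "K = (1 + 1 / \<eta>) / (1 - q) + 1"
  have K: "0 < K" using \<eta> q by (auto simp: K_def intro!: add_pos_pos divide_pos_pos)
  show thesis
  proof (rule that[OF K])
    fix u :: "real^'n \<Rightarrow> complex" and g \<delta>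
    assume u: "u \<in> L2" and g: "g \<in> L2" and w: "is_weak_gradient u g" and \<delta>: "0 < (\<delta>::real)"
    note [measurable] = L2_measurable[OF u]
    define m where "m = (\<integral>x. (norm (u x))\<^sup>2 \<partial>lborel)"
    define G where "G = (\<integral>x. (norm (g x))\<^sup>2 \<partial>lborel)"
    have m: "(\<integral>\<^sup>+x. ennreal ((norm (u x))\<^sup>2) \<partial>lborel) = ennreal m"
      unfolding m_def using u by (intro nn_integral_eq_integral) (auto simp: L2_def)
    have nonneg: "0 \<le> m" "0 \<le> G" by (auto simp: m_def G_def)
    let ?f = "\<lambda>x. ennreal ((norm (u x))\<^sup>2 * norm x powr - \<gamma>)"
    let ?M = "(q * (\<delta> powr - \<gamma> * m) + (1 + 1 / \<eta>) * (\<delta> powr (2 - \<gamma>) * G)) / (1 - q)"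
    \<comment> \<open>The shift by 2 keeps the inner radius below \<delta> from n = 0 on.\<close>
    define \<rho> where "\<rho> n = \<delta> / real (n + 2)" for n
    have \<rho>: "0 < \<rho> n" "\<rho> n < \<delta>" for n
      using \<delta> by (auto simp: \<rho>_def field_simps intro!: add_pos_nonneg)
    have \<rho>_lim: "\<rho> \<longlonglongrightarrow> 0"
      unfolding \<rho>_def by (rule LIMSEQ_ignore_initial_segment[OF lim_const_over_n])
    let ?A = "\<lambda>n. {x::real^'n. \<rho> n < norm x \<and> norm x \<le> \<delta>}"
    have [measurable]: "?A n \<in> sets borel" for n by measurable
    have "(\<integral>\<^sup>+x. ?f x \<partial>lborel) \<le> (\<integral>\<^sup>+x. liminf (\<lambda>n. ?f x * indicator (?A n) x + ennreal (\<delta> powr - \<gamma>) * ennreal ((norm (u x))\<^sup>2)) \<partial>lborel)"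
    proof (rule nn_integral_mono)
      fix x
      have "\<forall>\<^sub>F n in sequentially. ?f x \<le> ?f x * indicator (?A n) x + ennreal (\<delta> powr - \<gamma>) * ennreal ((norm (u x))\<^sup>2)"
      \<comment> \<open>The origin lies in no annulus, but there \<open>0 powr - \<gamma>\<close> is
        0 by convention, so it can be treated with the exterior.\<close>
      proof (cases "x = 0 \<or> norm x > \<delta>")
        case True
        then have "norm x powr - \<gamma> \<le> \<delta> powr - \<gamma>"
          using \<delta> \<gamma> by (cases "x = 0") (auto intro!: powr_mono2')
        then have "?f x \<le> ennreal (\<delta> powr - \<gamma>) * ennreal ((norm (u x))\<^sup>2)"
          by (subst ennreal_mult[symmetric]) (auto intro!: ennreal_leI mult_right_mono simp: mult.commute)
        then show ?thesis by (intro always_eventually allI) (simp add: add_increasing)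
      next
        case False
        then have "\<forall>\<^sub>F n in sequentially. \<rho> n < norm x"
          using \<rho>_lim by (intro order_tendstoD(2)) auto
        then show ?thesis
          by eventually_elim (use False in \<open>auto simp: indicator_def\<close>)
      qed
      then show "?f x \<le> liminf (\<lambda>n. ?f x * indicator (?A n) x + ennreal (\<delta> powr - \<gamma>) * ennreal ((norm (u x))\<^sup>2))"
        by (rule Liminf_bounded)
    qed
    also have "\<dots> \<le> liminf (\<lambda>n. \<integral>\<^sup>+x. ?f x * indicator (?A n) x + ennreal (\<delta> powr - \<gamma>) * ennreal ((norm (u x))\<^sup>2) \<partial>lborel)"
      by (rule nn_integral_liminf) measurable
    also have "\<dots> \<le> liminf (\<lambda>n. ennreal ?M + ennreal (\<delta> powr - \<gamma>) * ennreal m)"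
    proof (intro Liminf_mono always_eventually allI)
      fix n
      have "(\<integral>\<^sup>+x. ?f x * indicator (?A n) x \<partial>lborel) \<le> ennreal ?M"
        unfolding m_def G_def by (rule weighted_mass_annulus_le[OF u g w \<gamma>(1,2) \<rho> \<eta> q_def q(2)])
      then show "(\<integral>\<^sup>+x. ?f x * indicator (?A n) x + ennreal (\<delta> powr - \<gamma>) * ennreal ((norm (u x))\<^sup>2) \<partial>lborel)
         \<le> ennreal ?M + ennreal (\<delta> powr - \<gamma>) * ennreal m"
        by (subst nn_integral_add) (auto simp: nn_integral_cmult m intro!: add_right_mono)
    qed
    also have "\<dots> = ennreal (?M + \<delta> powr - \<gamma> * m)"
    proof -
      have "0 \<le> ?M" using q \<eta> nonneg by auto
      then show ?thesis using nonneg by (simp add: Liminf_const ennreal_mult)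
    qed
    also have "\<dots> \<le> ennreal (K * (\<delta> powr - \<gamma> * m + \<delta> powr (2 - \<gamma>) * G))"
    proof (rule ennreal_leI)
      have "q \<le> 1 + 1 / \<eta>" using q(2) \<eta> by (simp add: add_increasing2)
      then have "q * (\<delta> powr - \<gamma> * m) \<le> (1 + 1 / \<eta>) * (\<delta> powr - \<gamma> * m)"
        using nonneg by (intro mult_right_mono) auto
      then have "?M \<le> ((1 + 1 / \<eta>) * (\<delta> powr - \<gamma> * m) + (1 + 1 / \<eta>) * (\<delta> powr (2 - \<gamma>) * G)) / (1 - q)"
        using q by (intro divide_right_mono) auto
      also have "\<dots> = (1 + 1 / \<eta>) / (1 - q) * (\<delta> powr - \<gamma> * m + \<delta> powr (2 - \<gamma>) * G)"
        by (simp only: distrib_left[symmetric] times_divide_eq_left)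
      finally have "?M + \<delta> powr - \<gamma> * m \<le> (1 + 1 / \<eta>) / (1 - q) * (\<delta> powr - \<gamma> * m + \<delta> powr (2 - \<gamma>) * G)
          + (\<delta> powr - \<gamma> * m + \<delta> powr (2 - \<gamma>) * G)"
        by (rule add_mono) (use nonneg in simp)
      then show "?M + \<delta> powr - \<gamma> * m \<le> K * (\<delta> powr - \<gamma> * m + \<delta> powr (2 - \<gamma>) * G)"
        by (simp only: K_def distrib_right[of _ 1] mult_1)
    qed
    finally show "(\<integral>\<^sup>+x. ?f x \<partial>lborel) \<le>
      ennreal (K * (\<delta> powr - \<gamma> * (\<integral>x. (norm (u x))\<^sup>2 \<partial>lborel) + \<delta> powr (2 - \<gamma>) * (\<integral>x. (norm (g x))\<^sup>2 \<partial>lborel)))"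
      unfolding m_def G_def .
  qed
qed

text \<open>With x frozen, the inner integral is the weighted mass of the translate y -> u(y + x),
  which has the same mass and kinetic energy as \<open>u\<close>. The weighted bound is thus uniform
  in x, and integrating over x contributes one more factor of the mass.\<close>

lemma riesz_energy_le:
  fixes \<gamma> :: real
  assumes \<gamma>: "0 < \<gamma>" "\<gamma> < 2" "\<gamma> < CARD('n::finite)"
  obtains K where "0 < K"
    "\<And>(u :: real^'n \<Rightarrow> complex) g \<delta>. u \<in> L2 \<Longrightarrow> g \<in> L2 \<Longrightarrow> is_weak_gradient u g \<Longrightarrow> 0 < \<delta> \<Longrightarrow>
      riesz_energy \<gamma> u \<le> ennreal ((\<integral>x. (norm (u x))\<^sup>2 \<partial>lborel) *
        (K * (\<delta> powr - \<gamma> * (\<integral>x. (norm (u x))\<^sup>2 \<partial>lborel) + \<delta> powr (2 - \<gamma>) * (\<integral>x. (norm (g x))\<^sup>2 \<partial>lborel))))"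
proof -
  obtain K where K: "0 < K"
    "\<And>(u :: real^'n \<Rightarrow> complex) g \<delta>. u \<in> L2 \<Longrightarrow> g \<in> L2 \<Longrightarrow> is_weak_gradient u g \<Longrightarrow> 0 < \<delta> \<Longrightarrow>
      (\<integral>\<^sup>+x. ennreal ((norm (u x))\<^sup>2 * norm x powr - \<gamma>) \<partial>lborel) \<le>
      ennreal (K * (\<delta> powr - \<gamma> * (\<integral>x. (norm (u x))\<^sup>2 \<partial>lborel) + \<delta> powr (2 - \<gamma>) * (\<integral>x. (norm (g x))\<^sup>2 \<partial>lborel)))"
    by (rule weighted_mass_le[OF \<gamma>]) blast
  show thesis
  proof (rule that[OF K(1)])
    fix u :: "real^'n \<Rightarrow> complex" and g \<delta>
    assume u: "u \<in> L2" and g: "g \<in> L2" and w: "is_weak_gradient u g" and \<delta>: "0 < (\<delta>::real)"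
    note [measurable] = L2_measurable[OF u]
    define m where "m = (\<integral>x. (norm (u x))\<^sup>2 \<partial>lborel)"
    define G where "G = (\<integral>x. (norm (g x))\<^sup>2 \<partial>lborel)"
    have m: "(\<integral>\<^sup>+x. ennreal ((norm (u x))\<^sup>2) \<partial>lborel) = ennreal m"
      unfolding m_def using u by (intro nn_integral_eq_integral) (auto simp: L2_def)
    have nonneg: "0 \<le> m" "0 \<le> G" by (auto simp: m_def G_def)
    let ?B = "K * (\<delta> powr - \<gamma> * m + \<delta> powr (2 - \<gamma>) * G)"
    have "riesz_energy \<gamma> u \<le> (\<integral>\<^sup>+x. ennreal ((norm (u x))\<^sup>2) * ennreal ?B \<partial>lborel)"
      unfolding riesz_energy_def
    proof (rule nn_integral_mono)
      fix x :: "real^'n"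
      let ?v = "\<lambda>y. u (y + x)"
      have v: "?v \<in> L2" "(\<lambda>y. g (y + x)) \<in> L2" "is_weak_gradient ?v (\<lambda>y. g (y + x))"
        "(\<integral>y. (norm (?v y))\<^sup>2 \<partial>lborel) = m" "(\<integral>y. (norm (g (y + x)))\<^sup>2 \<partial>lborel) = G"
        using L2_affine[OF u, of 1 1 x] L2_affine[OF g, of 1 1 x] is_weak_gradient_affine[OF u g w, of 1 1 x]
        by (simp_all add: m_def G_def)
      have "(\<integral>\<^sup>+y. ennreal ((norm (u x))\<^sup>2 * (norm (u y))\<^sup>2 / norm (x - y) powr \<gamma>) \<partial>lborel) =
         (\<integral>\<^sup>+y. ennreal ((norm (u x))\<^sup>2) * ennreal ((norm (u y))\<^sup>2 * norm (x - y) powr - \<gamma>) \<partial>lborel)"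
        by (intro nn_integral_cong) (simp add: ennreal_mult[symmetric] powr_minus divide_inverse mult.assoc)
      also have "\<dots> = ennreal ((norm (u x))\<^sup>2) * (\<integral>\<^sup>+y. ennreal ((norm (u y))\<^sup>2 * norm (x - y) powr - \<gamma>) \<partial>lborel)"
        by (rule nn_integral_cmult) measurable
      also have "(\<integral>\<^sup>+y. ennreal ((norm (u y))\<^sup>2 * norm (x - y) powr - \<gamma>) \<partial>lborel) =
         (\<integral>\<^sup>+y. ennreal ((norm (?v y))\<^sup>2 * norm y powr - \<gamma>) \<partial>lborel)"
        using nn_integral_lborel_affine[of "\<lambda>y. ennreal ((norm (u y))\<^sup>2 * norm (x - y) powr - \<gamma>)" 1 x]
        by simp
      also have "\<dots> \<le> ennreal ?B"
        using K(2)[OF v(1-3) \<delta>] unfolding v(4,5) .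
      finally show "(\<integral>\<^sup>+y. ennreal ((norm (u x))\<^sup>2 * (norm (u y))\<^sup>2 / norm (x - y) powr \<gamma>) \<partial>lborel) \<le>
         ennreal ((norm (u x))\<^sup>2) * ennreal ?B"
        by (simp add: mult_left_mono)
    qed
    also have "\<dots> = ennreal m * ennreal ?B"
      by (simp add: nn_integral_multc m)
    also have "\<dots> = ennreal (m * ?B)"
      using nonneg K(1) by (simp add: ennreal_mult)
    finally show "riesz_energy \<gamma> u \<le> ennreal ((\<integral>x. (norm (u x))\<^sup>2 \<partial>lborel) *
        (K * (\<delta> powr - \<gamma> * (\<integral>x. (norm (u x))\<^sup>2 \<partial>lborel) + \<delta> powr (2 - \<gamma>) * (\<integral>x. (norm (g x))\<^sup>2 \<partial>lborel))))"
      unfolding m_def G_def .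
  qed
qed

section \<open>Infima of affine functions of the mass\<close>

text \<open>In this abstract setting \<open>A\<close> stands for the kinetic term and \<open>B\<close> for the difference of the
  Riesz terms of a state of mass 1, and \<open>min_quotient c = m c / c\<close>, which is an infimum of affine
  functions of \<open>c\<close> and hence concave.\<close>
locale mass_scaling =
  fixes J :: "(real \<times> real) set" and a d\<^sub>1 d\<^sub>2 \<gamma>\<^sub>1 \<gamma>\<^sub>2 :: real
  assumes \<gamma>: "0 < \<gamma>\<^sub>2" "\<gamma>\<^sub>2 < \<gamma>\<^sub>1"
    and family: "\<And>l. 0 < l \<Longrightarrow> (l\<^sup>2 * a, l powr \<gamma>\<^sub>2 * d\<^sub>2 - l powr \<gamma>\<^sub>1 * d\<^sub>1) \<in> J"
    and d\<^sub>1: "0 < d\<^sub>1" and d\<^sub>2: "0 \<le> d\<^sub>2"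
    and fst_nonneg: "\<And>A B. (A, B) \<in> J \<Longrightarrow> 0 \<le> A"
    and lower: "\<And>\<epsilon>. 0 < \<epsilon> \<Longrightarrow> \<exists>C. \<forall>(A, B)\<in>J. - (\<epsilon> * A + C) \<le> B"
begin

definition state_quotient :: "real \<Rightarrow> real \<times> real \<Rightarrow> real" where
  "state_quotient c p = fst p / 2 + c / 4 * snd p"

definition min_quotient :: "real \<Rightarrow> real" where "min_quotient c = (INF p\<in>J. state_quotient c p)"

lemma J_nonempty: "J \<noteq> {}"
  using family[of 1] by auto

text \<open>The condition \<open>c * \<epsilon> \<le> 2\<close> says exactly that the half of
  \<open>A\<close> in the quotient pays for the loss \<open>c / 4 * \<epsilon> * A\<close>. The
  constant depends on \<epsilon> alone, so one choice serves a whole range of c: \<epsilon> = 2 / c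
  gives finiteness, \<epsilon> = 1 the limit at 0.\<close>

lemma state_quotient_lower:
  assumes "0 < \<epsilon>"
  obtains C where "0 \<le> C" "\<And>c p. p \<in> J \<Longrightarrow> 0 < c \<Longrightarrow> c * \<epsilon> \<le> 2 \<Longrightarrow> - (c / 4 * C) \<le> state_quotient c p"
proof -
  obtain C where C: "\<forall>(A, B)\<in>J. - (\<epsilon> * A + C) \<le> B" using lower[OF assms] by blast
  have "- (c / 4 * \<bar>C\<bar>) \<le> state_quotient c p" if "p \<in> J" "0 < c" "c * \<epsilon> \<le> 2" for c p
  proof -
    obtain A B where p: "p = (A, B)" by (cases p)
    have A: "0 \<le> A" and B: "- (\<epsilon> * A + \<bar>C\<bar>) \<le> B" using C fst_nonneg that(1) p by fastforce+
    have "c / 4 * - (\<epsilon> * A + \<bar>C\<bar>) \<le> c / 4 * B" using B that(2) by (intro mult_left_mono) auto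
    moreover have "c * \<epsilon> * A \<le> 2 * A" using that(3) A by (rule mult_right_mono)
    ultimately show ?thesis by (simp add: state_quotient_def p algebra_simps)
  qed
  then show thesis using that[of "\<bar>C\<bar>"] by simp
qed

lemma bdd_below_state_quotient: assumes "0 < c" shows "bdd_below (state_quotient c ` J)"
proof -
  obtain C where "0 \<le> C" "\<And>c' p. p \<in> J \<Longrightarrow> 0 < c' \<Longrightarrow> c' * (2 / c) \<le> 2 \<Longrightarrow> - (c' / 4 * C) \<le> state_quotient c' p"
    using state_quotient_lower[of "2 / c"] assms by auto
  from this(2)[of _ c] show ?thesis using assms by (intro bdd_belowI[of _ "- (c / 4 * C)"]) auto
qed

lemma min_quotient_le: "0 < c \<Longrightarrow> p \<in> J \<Longrightarrow> min_quotient c \<le> state_quotient c p"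
  unfolding min_quotient_def by (rule cINF_lower[OF bdd_below_state_quotient])

lemma min_quotient_greatest: "(\<And>p. p \<in> J \<Longrightarrow> z \<le> state_quotient c p) \<Longrightarrow> z \<le> min_quotient c"
  unfolding min_quotient_def by (rule cINF_greatest[OF J_nonempty])

text \<open>Passage from the extended to the real infimum: a continuous increasing map commutes with
  the infimum of a nonempty set that is bounded below.\<close>

lemma INF_eq_min_quotient:
  assumes "0 < c"
  shows "(INF (A, B)\<in>J. ereal (c / 2 * A + c\<^sup>2 / 4 * B)) = ereal (c * min_quotient c)"
proof -
  have "ereal (c * min_quotient c) = (INF z\<in>state_quotient c ` J. ereal (c * z))"
    unfolding min_quotient_def
  proof (rule continuous_at_Inf_mono)
    show "mono (\<lambda>z. ereal (c * z))" using assms by (auto intro!: monoI mult_left_mono)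
    show "continuous (at_right (Inf (state_quotient c ` J))) (\<lambda>z. ereal (c * z))"
      by (intro continuous_intros continuous_at_imp_continuous_within)
  qed (use J_nonempty bdd_below_state_quotient[OF assms] in auto)
  also have "\<dots> = (INF (A, B)\<in>J. ereal (c / 2 * A + c\<^sup>2 / 4 * B))"
    by (simp add: image_comp comp_def state_quotient_def case_prod_unfold power2_eq_square algebra_simps)
  finally show ?thesis ..
qed

text \<open>Small \<open>l\<close> spreads the model state out; the exponents 2,
  \<open>\<gamma>\<^sub>2\<close> and \<open>\<gamma>\<^sub>1\<close> being positive, all its
  contributions vanish in the limit.\<close>

lemma min_quotient_nonpos: assumes "0 < c" shows "min_quotient c \<le> 0"
proof (rule tendsto_lowerbound)
  have "((\<lambda>l. l powr e) \<longlongrightarrow> 0) (at_right 0)" if "0 < e" for e :: real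
    by (rule tendsto_zero_powrI[OF _ tendsto_const])
      (use that in \<open>auto intro!: tendsto_intros simp: eventually_at_filter\<close>)
  then have "((\<lambda>l. l\<^sup>2 * a / 2 + c / 4 * (l powr \<gamma>\<^sub>2 * d\<^sub>2 - l powr \<gamma>\<^sub>1 * d\<^sub>1)) \<longlongrightarrow>
      0\<^sup>2 * a / 2 + c / 4 * (0 * d\<^sub>2 - 0 * d\<^sub>1)) (at_right 0)"
    using \<gamma> by (intro tendsto_intros) auto
  then show "((\<lambda>l. l\<^sup>2 * a / 2 + c / 4 * (l powr \<gamma>\<^sub>2 * d\<^sub>2 - l powr \<gamma>\<^sub>1 * d\<^sub>1)) \<longlongrightarrow> 0) (at_right 0)"
    by simp
  show "\<forall>\<^sub>F l in at_right 0. min_quotient c \<le> l\<^sup>2 * a / 2 + c / 4 * (l powr \<gamma>\<^sub>2 * d\<^sub>2 - l powr \<gamma>\<^sub>1 * d\<^sub>1)"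
    unfolding eventually_at_filter
    by (intro always_eventually allI impI) (use min_quotient_le[OF assms family] in \<open>auto simp: state_quotient_def\<close>)
qed simp

lemma min_quotient_antimono: assumes "0 < b" "b \<le> c" shows "min_quotient c \<le> min_quotient b"
proof (rule min_quotient_greatest)
  fix p assume p: "p \<in> J"
  show "min_quotient c \<le> state_quotient b p"
  proof (cases "snd p \<le> 0")
    case True
    then have "c / 4 * snd p \<le> b / 4 * snd p" using assms by (intro mult_right_mono_neg) auto
    then show ?thesis using min_quotient_le[of c p] assms p by (simp add: state_quotient_def)
  next
    case False
    then have "0 \<le> state_quotient b p" using fst_nonneg[of "fst p" "snd p"] p assms by (simp add: state_quotient_def)
    then show ?thesis using min_quotient_nonpos[of c] assms by linarith
  qed
qed

lemma continuous_on_min_quotient: "continuous_on {0<..} min_quotient"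
proof -
  have "convex_on {0<..} (\<lambda>c. - min_quotient c)"
  proof (rule convex_onI)
    fix t x y :: real assume t: "0 < t" "t < 1" and xy: "x \<in> {0<..}" "y \<in> {0<..}"
    have "(1 - t) * min_quotient x + t * min_quotient y \<le> min_quotient ((1 - t) * x + t * y)"
    proof (rule min_quotient_greatest)
      fix p assume p: "p \<in> J"
      have "(1 - t) * min_quotient x + t * min_quotient y \<le> (1 - t) * state_quotient x p + t * state_quotient y p"
        using t xy p by (intro add_mono mult_left_mono min_quotient_le) auto
      also have "\<dots> = state_quotient ((1 - t) * x + t * y) p" by (simp add: state_quotient_def field_simps)
      finally show "(1 - t) * min_quotient x + t * min_quotient y \<le> state_quotient ((1 - t) * x + t * y) p" .
    qed
    then show "- min_quotient ((1 - t) *\<^sub>R x + t *\<^sub>R y) \<le> (1 - t) * - min_quotient x + t * - min_quotient y" by simp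
  qed (rule convex_real_interval)
  from continuous_on_minus[OF convex_on_continuous[OF open_greaterThan this]] show ?thesis by simp
qed

lemma exists_negative: obtains A B where "(A, B) \<in> J" "B < 0"
proof -
  \<comment> \<open>This solves \<open>l powr (\<gamma>\<^sub>1 - \<gamma>\<^sub>2) = d\<^sub>2 /
    d\<^sub>1 + 1\<close>, just beyond the balance of the two Riesz terms. The summand 1 makes the
    inequality strict and the base positive.\<close>
  define l where "l = (d\<^sub>2 / d\<^sub>1 + 1) powr (1 / (\<gamma>\<^sub>1 - \<gamma>\<^sub>2))"
  have pos: "0 < d\<^sub>2 / d\<^sub>1 + 1" using d\<^sub>1 d\<^sub>2 by (simp add: add_nonneg_pos)
  then have l: "0 < l" by (simp add: l_def)
  have "l powr (\<gamma>\<^sub>1 - \<gamma>\<^sub>2) = d\<^sub>2 / d\<^sub>1 + 1"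
    using \<gamma> pos by (simp add: l_def powr_powr)
  then have "d\<^sub>2 < l powr (\<gamma>\<^sub>1 - \<gamma>\<^sub>2) * d\<^sub>1" using d\<^sub>1 by (simp add: field_simps)
  then have "l powr \<gamma>\<^sub>2 * d\<^sub>2 < l powr \<gamma>\<^sub>2 * (l powr (\<gamma>\<^sub>1 - \<gamma>\<^sub>2) * d\<^sub>1)"
    using l by (intro mult_strict_left_mono) auto
  also have "\<dots> = l powr \<gamma>\<^sub>1 * d\<^sub>1" by (simp add: mult.assoc[symmetric] powr_add[symmetric])
  finally show thesis using family[OF l] that by auto
qed

theorem min_properties:
  fixes m :: "real \<Rightarrow> ereal"
  assumes m0: "m 0 = 0" and m: "\<And>c. 0 < c \<Longrightarrow> m c = (INF (A, B)\<in>J. ereal (c / 2 * A + c\<^sup>2 / 4 * B))"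
  shows "(\<forall>c\<ge>0. - \<infinity> < m c \<and> m c \<le> 0)
    \<and> (\<forall>c>0. isCont m c)
    \<and> (\<forall>c c\<^sub>1 c\<^sub>2. 0 \<le> c\<^sub>1 \<and> 0 \<le> c\<^sub>2 \<and> c = c\<^sub>1 + c\<^sub>2 \<and> 0 < c \<longrightarrow> m c \<le> m c\<^sub>1 + m c\<^sub>2)
    \<and> antimono_on {0<..} m
    \<and> (m \<longlongrightarrow> 0) (at_right 0)
    \<and> (m \<longlongrightarrow> - \<infinity>) at_top"
proof (intro conjI allI impI)
  have m_eq: "m c = ereal (c * min_quotient c)" if "0 < c" for c using that m INF_eq_min_quotient by simp
  show "- \<infinity> < m c" if "0 \<le> c" for c
    using that by (cases "c = 0") (auto simp: m0 m_eq)
  show "m c \<le> 0" if "0 \<le> c" for c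
    using that min_quotient_nonpos[of c] by (cases "c = 0") (auto simp: m0 m_eq mult_le_0_iff)
  show "isCont m c" if "0 < c" for c
  proof -
    have "isCont min_quotient c" using continuous_on_min_quotient that by (simp add: continuous_on_eq_continuous_at)
    then have "isCont (\<lambda>c. ereal (c * min_quotient c)) c" by (intro continuous_intros)
    moreover have "\<forall>\<^sub>F x in nhds c. m x = ereal (x * min_quotient x)"
      using eventually_nhds_in_open[of "{0<..}" c] that
      by (auto elim!: eventually_mono simp: m_eq)
    ultimately show ?thesis by (simp add: isCont_cong)
  qed
  show "m c \<le> m c\<^sub>1 + m c\<^sub>2" if "0 \<le> c\<^sub>1 \<and> 0 \<le> c\<^sub>2 \<and> c = c\<^sub>1 + c\<^sub>2 \<and> 0 < c" for c c\<^sub>1 c\<^sub>2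
  \<comment> \<open>The quotient m(c) / c carries no information at mass 0, so a vanishing part is
    settled by \<open>m0\<close>.\<close>
  proof (cases "c\<^sub>1 = 0 \<or> c\<^sub>2 = 0")
    case True
    then show ?thesis using that by (auto simp: m0)
  next
    case False
    then have pos: "0 < c\<^sub>1" "0 < c\<^sub>2" using that by auto
    then have "c\<^sub>1 * min_quotient c + c\<^sub>2 * min_quotient c \<le> c\<^sub>1 * min_quotient c\<^sub>1 + c\<^sub>2 * min_quotient c\<^sub>2"
      using that by (intro add_mono mult_left_mono min_quotient_antimono) auto
    then show ?thesis using pos that by (simp add: m_eq distrib_right)
  qed
  show "antimono_on {0<..} m"
  proof (rule monotone_onI)
    fix b c :: real assume *: "b \<in> {0<..}" "c \<in> {0<..}" "b \<le> c"
    \<comment> \<open>Lowering the prefactor from c to b uses the sign of the quotient; the next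
      step uses its monotonicity.\<close>
    then have "c * min_quotient c \<le> b * min_quotient c" using min_quotient_nonpos[of c] by (intro mult_right_mono_neg) auto
    also have "\<dots> \<le> b * min_quotient b" using * by (intro mult_left_mono min_quotient_antimono) auto
    finally show "m c \<le> m b" using * by (simp add: m_eq)
  qed
  show "(m \<longlongrightarrow> 0) (at_right 0)"
  proof -
    \<comment> \<open>One constant is valid for all c up to 2, so m(c) lies between a multiple of
      the square of c and 0.\<close>
    obtain C where C: "\<And>c p. p \<in> J \<Longrightarrow> 0 < c \<Longrightarrow> c * 1 \<le> 2 \<Longrightarrow> - (c / 4 * C) \<le> state_quotient c p"
      by (rule state_quotient_lower[OF zero_less_one]) blast
    have ev: "\<forall>\<^sub>F c in at_right 0. 0 < c \<and> c \<le> (2::real)"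
      unfolding eventually_at_right_field by (rule exI[of _ 2]) auto
    have "((\<lambda>c. c * min_quotient c) \<longlongrightarrow> 0) (at_right 0)"
    proof (rule tendsto_sandwich)
      show "\<forall>\<^sub>F c in at_right 0. - (c * (c / 4 * C)) \<le> c * min_quotient c"
        using ev
      proof eventually_elim
        case (elim c)
        then have "c * - (c / 4 * C) \<le> c * min_quotient c"
          by (intro mult_left_mono min_quotient_greatest C) auto
        then show ?case by simp
      qed
      show "\<forall>\<^sub>F c in at_right 0. c * min_quotient c \<le> 0"
        using ev by eventually_elim (auto simp: mult_le_0_iff min_quotient_nonpos)
      have "((\<lambda>c. - (c * (c / 4 * C))) \<longlongrightarrow> - (0 * (0 / 4 * C))) (at_right 0)" by (intro tendsto_intros) auto
      then show "((\<lambda>c. - (c * (c / 4 * C))) \<longlongrightarrow> 0) (at_right 0)" by simp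
    qed auto
    then have "((\<lambda>c. ereal (c * min_quotient c)) \<longlongrightarrow> ereal 0) (at_right 0)" by simp
    moreover have "\<forall>\<^sub>F c in at_right 0. ereal (c * min_quotient c) = m c"
      using ev by eventually_elim (simp add: m_eq)
    ultimately show ?thesis unfolding zero_ereal_def by (rule Lim_transform_eventually)
  qed
  show "(m \<longlongrightarrow> - \<infinity>) at_top"
    unfolding tendsto_MInfty
  proof
    fix r :: real
    obtain A B where AB: "(A, B) \<in> J" "B < 0" by (rule exists_negative)
    \<comment> \<open>A single state with \<open>B < 0\<close> bounds m(c) from above by a quadratic
      polynomial in c with leading coefficient B / 4.\<close>
    have "filterlim (\<lambda>c. c * (- A / 2 + - B / 4 * c)) at_top at_top"
      using AB(2) by (intro filterlim_at_top_mult_at_top[OF filterlim_ident] filterlim_ident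
        filterlim_tendsto_add_at_top[OF tendsto_const] filterlim_tendsto_pos_mult_at_top[OF tendsto_const]) auto
    then have "filterlim (\<lambda>c. c * (A / 2 + c / 4 * B)) at_bot at_top"
      unfolding filterlim_uminus_at_bot by (simp add: algebra_simps)
    then have "\<forall>\<^sub>F c in at_top. c * (A / 2 + c / 4 * B) < r"
      by (simp add: filterlim_at_bot_dense)
    then show "\<forall>\<^sub>F c in at_top. m c < ereal r"
      using eventually_gt_at_top[of 0]
    proof eventually_elim
      case (elim c)
      have "c * min_quotient c \<le> c * state_quotient c (A, B)" using elim AB(1) by (intro mult_left_mono min_quotient_le) auto
      also have "\<dots> < r" using elim(1) by (simp add: state_quotient_def)
      finally show ?case using elim(2) by (simp add: m_eq)
    qed
  qed
qed

end

section \<open>Scaling of the energy\<close>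

lemma H1_iff: "u \<in> H1 \<longleftrightarrow> u \<in> L2 \<and> (\<exists>g\<in>L2. is_weak_gradient u g)"
  by (simp add: H1_def)

text \<open>Four amplitude factors give \<open>k ^ 4\<close>, the kernel is homogeneous of degree
  -\<gamma>, and each of the two integrations contributes one Jacobian.\<close>

lemma riesz_energy_dilation:
  fixes u :: "real^'n::finite \<Rightarrow> complex"
  assumes [measurable]: "u \<in> borel_measurable borel" and s: "0 < s"
  shows "riesz_energy \<gamma> (\<lambda>x. k *\<^sub>R u (s *\<^sub>R x)) =
    ennreal (k ^ 4 * s powr \<gamma> * ((1 / s) ^ CARD('n))\<^sup>2) * riesz_energy \<gamma> u"
proof -
  let ?F = "\<lambda>x y. ennreal ((norm (u x))\<^sup>2 * (norm (u y))\<^sup>2 / norm (x - y) powr \<gamma>)"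
  let ?H = "\<lambda>x. \<integral>\<^sup>+y. ?F x y \<partial>lborel"
  let ?c = "k ^ 4 * s powr \<gamma>" and ?r = "(1 / s) ^ CARD('n)"
  have "(\<integral>\<^sup>+y. ennreal ((norm (k *\<^sub>R u (s *\<^sub>R x)))\<^sup>2 * (norm (k *\<^sub>R u (s *\<^sub>R y)))\<^sup>2 / norm (x - y) powr \<gamma>) \<partial>lborel) =
      ennreal (?c * ?r) * ?H (s *\<^sub>R x)" for x
  proof -
    have "ennreal ((norm (k *\<^sub>R u (s *\<^sub>R x)))\<^sup>2 * (norm (k *\<^sub>R u (s *\<^sub>R y)))\<^sup>2 / norm (x - y) powr \<gamma>) =
       ennreal ?c * ?F (s *\<^sub>R x) (s *\<^sub>R y + 0)" for y
    proof -
      have n: "norm (s *\<^sub>R x - s *\<^sub>R y) = s * norm (x - y)"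
        using s by (simp flip: scaleR_diff_right)
      have k4: "k ^ 4 = k\<^sup>2 * k\<^sup>2" by (simp add: power2_eq_square power4_eq_xxxx)
      have "(norm (k *\<^sub>R u (s *\<^sub>R x)))\<^sup>2 * (norm (k *\<^sub>R u (s *\<^sub>R y)))\<^sup>2 / norm (x - y) powr \<gamma> =
        ?c * ((norm (u (s *\<^sub>R x)))\<^sup>2 * (norm (u (s *\<^sub>R y)))\<^sup>2 / norm (s *\<^sub>R x - s *\<^sub>R y) powr \<gamma>)"
        using s unfolding n k4 by (simp add: powr_mult power_mult_distrib)
      then have "ennreal ((norm (k *\<^sub>R u (s *\<^sub>R x)))\<^sup>2 * (norm (k *\<^sub>R u (s *\<^sub>R y)))\<^sup>2 / norm (x - y) powr \<gamma>) =
          ennreal (?c * ((norm (u (s *\<^sub>R x)))\<^sup>2 * (norm (u (s *\<^sub>R y)))\<^sup>2 / norm (s *\<^sub>R x - s *\<^sub>R y) powr \<gamma>))"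
        by (simp only:)
      also have "\<dots> = ennreal ?c * ?F (s *\<^sub>R x) (s *\<^sub>R y)"
        by (rule ennreal_mult) auto
      finally show ?thesis by (simp only: add_0_right)
    qed
    then have "(\<integral>\<^sup>+y. ennreal ((norm (k *\<^sub>R u (s *\<^sub>R x)))\<^sup>2 * (norm (k *\<^sub>R u (s *\<^sub>R y)))\<^sup>2 / norm (x - y) powr \<gamma>) \<partial>lborel) =
       (\<integral>\<^sup>+y. ennreal ?c * ?F (s *\<^sub>R x) (s *\<^sub>R y + 0) \<partial>lborel)" by simp
    also have "\<dots> = ennreal ?c * (\<integral>\<^sup>+y. ?F (s *\<^sub>R x) (s *\<^sub>R y + 0) \<partial>lborel)"
      by (rule nn_integral_cmult) measurable
    also have "(\<integral>\<^sup>+y. ?F (s *\<^sub>R x) (s *\<^sub>R y + 0) \<partial>lborel) = ennreal ?r * ?H (s *\<^sub>R x)"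
      by (rule nn_integral_lborel_affine[where f="?F (s *\<^sub>R x)"]) (use s in measurable)
    finally show ?thesis using s by (simp add: ennreal_mult mult.assoc)
  qed
  then have "riesz_energy \<gamma> (\<lambda>x. k *\<^sub>R u (s *\<^sub>R x)) = (\<integral>\<^sup>+x. ennreal (?c * ?r) * ?H (s *\<^sub>R x + 0) \<partial>lborel)"
    by (simp add: riesz_energy_def)
  also have "\<dots> = ennreal (?c * ?r) * (\<integral>\<^sup>+x. ?H (s *\<^sub>R x + 0) \<partial>lborel)"
    by (rule nn_integral_cmult) measurable
  also have "(\<integral>\<^sup>+x. ?H (s *\<^sub>R x + 0) \<partial>lborel) = ennreal ?r * (\<integral>\<^sup>+x. ?H x \<partial>lborel)"
    using s by (intro nn_integral_lborel_affine[where f="?H"]) auto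
  finally show ?thesis
    using s by (simp add: riesz_energy_def ennreal_mult mult.assoc power2_eq_square)
qed

lemma riesz_energy_pos:
  fixes u :: "real^'n::finite \<Rightarrow> complex"
  assumes [measurable]: "u \<in> borel_measurable borel" and "\<not> (AE x in lborel. u x = 0)"
  shows "riesz_energy \<gamma> u \<noteq> 0"
proof
  assume "riesz_energy \<gamma> u = 0"
  then have "AE x in lborel. (\<integral>\<^sup>+y. ennreal ((norm (u x))\<^sup>2 * (norm (u y))\<^sup>2 / norm (x - y) powr \<gamma>) \<partial>lborel) = 0"
    unfolding riesz_energy_def by (subst (asm) nn_integral_0_iff_AE) auto
  then have *: "AE x in lborel. AE y in lborel. ennreal ((norm (u x))\<^sup>2 * (norm (u y))\<^sup>2 / norm (x - y) powr \<gamma>) = 0"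
    by eventually_elim (subst (asm) nn_integral_0_iff_AE, auto)
  have "AE x in lborel. u x = 0"
    using *
  proof eventually_elim
    case (elim x)
    show "u x = 0"
    proof (rule ccontr)
      assume ux: "u x \<noteq> 0"
      \<comment> \<open>The point y = x has to be excluded, since division by 0 makes the integrand
        0 there whatever the value of \<open>u\<close>; a single point is a null set.\<close>
      have "AE y in lborel. u y = 0"
        using elim AE_lborel_singleton[of x]
      proof eventually_elim
        case (elim y)
        then have "(norm (u x))\<^sup>2 * (norm (u y))\<^sup>2 / norm (x - y) powr \<gamma> \<le> 0" by (simp add: ennreal_eq_0_iff)
        moreover have "0 < norm (x - y) powr \<gamma>" using elim by simp
        ultimately show "u y = 0" using ux by (auto simp: divide_le_0_iff mult_le_0_iff)
      qed
      with assms(2) show False by blast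
    qed
  qed
  with assms(2) show False by blast
qed

text \<open>With both Riesz terms finite the extended arithmetic of \<open>energy\<close> is real
  arithmetic, and any weak gradient may stand in for the chosen one.\<close>

lemma energy_eq:
  fixes u :: "real^'n::finite \<Rightarrow> complex"
  assumes "g \<in> L2" "is_weak_gradient u g" "riesz_energy \<gamma>\<^sub>1 u < \<infinity>" "riesz_energy \<gamma>\<^sub>2 u < \<infinity>"
  shows "energy \<gamma>\<^sub>1 \<gamma>\<^sub>2 u = ereal (1/2 * (\<integral>x. (norm (g x))\<^sup>2 \<partial>lborel)
    + 1/4 * (enn2real (riesz_energy \<gamma>\<^sub>2 u) - enn2real (riesz_energy \<gamma>\<^sub>1 u)))"
proof -
  have "enn2ereal r = ereal (enn2real r)" if "r < \<infinity>" for r :: ennreal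
    using that by (cases r) (auto simp: enn2ereal_ennreal)
  then show ?thesis
    using assms unfolding energy_def weak_gradient_norm[OF assms(1,2)] by (simp add: algebra_simps)
qed

text \<open>This is the set \<open>J\<close> of the abstract setting. Admitting every weak gradient
  adds no pairs, as all of them have the same norm, and spares the use of the choice
  operator.\<close>

definition unit_mass_energies :: "'n::finite itself \<Rightarrow> real \<Rightarrow> real \<Rightarrow> (real \<times> real) set" where
  "unit_mass_energies TYPE('n) \<gamma>\<^sub>1 \<gamma>\<^sub>2 =
    {(\<integral>x. (norm (g x))\<^sup>2 \<partial>lborel, enn2real (riesz_energy \<gamma>\<^sub>2 u) - enn2real (riesz_energy \<gamma>\<^sub>1 u)) | u g.
      (u :: real^'n \<Rightarrow> complex) \<in> L2 \<and> g \<in> L2 \<and> is_weak_gradient u g \<and> (\<integral>x. (norm (u x))\<^sup>2 \<partial>lborel) = 1}"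

text \<open>The witness is x -> k u(l x), with \<open>k\<close> restoring mass 1. Taking l = 1
  normalises an arbitrary state of positive mass; letting l vary produces the dilation family of one
  state.\<close>

lemma unit_mass_energiesI:
  fixes u :: "real^'n::finite \<Rightarrow> complex"
  assumes u: "u \<in> L2" "g \<in> L2" "is_weak_gradient u g" and l: "0 < l"
    and k: "k\<^sup>2 * (1 / l) ^ CARD('n) * (\<integral>x. (norm (u x))\<^sup>2 \<partial>lborel) = 1"
  shows "(l\<^sup>2 * ((\<integral>x. (norm (g x))\<^sup>2 \<partial>lborel) / (\<integral>x. (norm (u x))\<^sup>2 \<partial>lborel)),
     l powr \<gamma>\<^sub>2 * (enn2real (riesz_energy \<gamma>\<^sub>2 u) / (\<integral>x. (norm (u x))\<^sup>2 \<partial>lborel)\<^sup>2)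
     - l powr \<gamma>\<^sub>1 * (enn2real (riesz_energy \<gamma>\<^sub>1 u) / (\<integral>x. (norm (u x))\<^sup>2 \<partial>lborel)\<^sup>2)) \<in> unit_mass_energies TYPE('n) \<gamma>\<^sub>1 \<gamma>\<^sub>2"
proof -
  define M where "M = (\<integral>x. (norm (u x))\<^sup>2 \<partial>lborel)"
  let ?r = "(1 / l) ^ CARD('n)"
  let ?v = "\<lambda>x. k *\<^sub>R u (l *\<^sub>R x)" and ?h = "\<lambda>x. (k * l) *\<^sub>R g (l *\<^sub>R x)"
  have v: "?v \<in> L2" "?h \<in> L2" "is_weak_gradient ?v ?h"
    "(\<integral>x. (norm (?v x))\<^sup>2 \<partial>lborel) = 1"
    "(\<integral>x. (norm (?h x))\<^sup>2 \<partial>lborel) = (k * l)\<^sup>2 * ?r * (\<integral>x. (norm (g x))\<^sup>2 \<partial>lborel)"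
    using L2_affine[OF u(1) l, of k 0] L2_affine[OF u(2) l, of "k * l" 0] is_weak_gradient_affine[OF u l, of k 0] k
    by simp_all
  \<comment> \<open>The normalisation has value 1, so it also shows that the mass \<open>M\<close>
    is not 0.\<close>
  have kr: "k\<^sup>2 * ?r = 1 / M" using k by (metis M_def nonzero_eq_divide_eq mult_zero_right zero_neq_one)
  have k4: "k ^ 4 * ?r\<^sup>2 = 1 / M\<^sup>2"
  proof -
    have "k ^ 4 * ?r\<^sup>2 = (k\<^sup>2 * ?r)\<^sup>2" by (simp add: power_mult_distrib power_mult[symmetric])
    also have "\<dots> = (1 / M)\<^sup>2" by (simp only: kr)
    finally show ?thesis by (simp add: power_divide)
  qed
  have D: "enn2real (riesz_energy \<gamma> ?v) = l powr \<gamma> * (enn2real (riesz_energy \<gamma> u) / M\<^sup>2)" for \<gamma>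
  proof -
    have "k ^ 4 * l powr \<gamma> * ?r\<^sup>2 = l powr \<gamma> / M\<^sup>2" using k4 by (simp add: mult_ac)
    then have "riesz_energy \<gamma> ?v = ennreal (l powr \<gamma> / M\<^sup>2) * riesz_energy \<gamma> u"
      using riesz_energy_dilation[OF L2_measurable[OF u(1)] l, of \<gamma> k] by (simp only:)
    then show ?thesis by (simp add: enn2real_mult)
  qed
  have "(k * l)\<^sup>2 * ?r = l\<^sup>2 * (k\<^sup>2 * ?r)" by (simp add: power_mult_distrib)
  then have G: "(\<integral>x. (norm (?h x))\<^sup>2 \<partial>lborel) = l\<^sup>2 * ((\<integral>x. (norm (g x))\<^sup>2 \<partial>lborel) / M)"
    unfolding v(5) kr by simp
  show ?thesis
    unfolding M_def[symmetric] G[symmetric] D[symmetric] unit_mass_energies_def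
    by (rule CollectI, rule exI[of _ ?v], rule exI[of _ ?h]) (simp only: v simp_thms)
qed

section \<open>The scaling hypotheses for the Riesz energies\<close>

context
  fixes \<gamma>\<^sub>1 \<gamma>\<^sub>2 :: real
  assumes \<gamma>: "0 < \<gamma>\<^sub>2" "\<gamma>\<^sub>2 < \<gamma>\<^sub>1" "\<gamma>\<^sub>1 < min (real CARD('n::finite)) 2"
begin

lemma riesz_energy_finite:
  fixes u :: "real^'n \<Rightarrow> complex"
  assumes "u \<in> H1" shows "riesz_energy \<gamma>\<^sub>1 u < \<infinity>" "riesz_energy \<gamma>\<^sub>2 u < \<infinity>"
proof -
  obtain g where g: "u \<in> L2" "g \<in> L2" "is_weak_gradient u g" using assms by (auto simp: H1_iff)
  have "riesz_energy \<gamma> u < \<infinity>" if "0 < \<gamma>" "\<gamma> < 2" "\<gamma> < real CARD('n)" for \<gamma>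
  proof -
    have "\<exists>B. riesz_energy \<gamma> u \<le> ennreal B"
      by (rule riesz_energy_le[OF that]) (use g zero_less_one in blast)
    then show ?thesis by (metis ennreal_less_top infinity_ennreal_def order_le_less_trans)
  qed
  then show "riesz_energy \<gamma>\<^sub>1 u < \<infinity>" "riesz_energy \<gamma>\<^sub>2 u < \<infinity>" using \<gamma> by auto
qed

text \<open>The zero function gives the upper bound. For the lower one, the mass is a factor of the
  Riesz bound, so the attractive term of any state of mass 0 vanishes and only nonnegative terms
  remain.\<close>

lemma min_energy_zero: "min_energy TYPE('n) \<gamma>\<^sub>1 \<gamma>\<^sub>2 0 = 0"
  unfolding min_energy_def
proof (rule antisym)
  let ?z = "\<lambda>_. 0 :: complex"
  have z: "(\<lambda>_::real^'n. 0) \<in> L2" "(\<lambda>_::real^'n. 0::complex^'n) \<in> L2" "is_weak_gradient (?z :: real^'n \<Rightarrow> complex) (\<lambda>_. 0)"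
    by (auto simp: L2_def is_weak_gradient_def)
  then have "(?z :: real^'n \<Rightarrow> complex) \<in> mass_sphere 0" by (auto simp: mass_sphere_def H1_iff)
  moreover have "energy \<gamma>\<^sub>1 \<gamma>\<^sub>2 (?z :: real^'n \<Rightarrow> complex) = 0"
    using energy_eq[OF z(2,3), of \<gamma>\<^sub>1 \<gamma>\<^sub>2] by (simp add: riesz_energy_def)
  ultimately show "(INF u\<in>(mass_sphere 0 :: (real^'n \<Rightarrow> complex) set). energy \<gamma>\<^sub>1 \<gamma>\<^sub>2 u) \<le> 0"
    by (metis INF_lower)
  show "0 \<le> (INF u\<in>(mass_sphere 0 :: (real^'n \<Rightarrow> complex) set). energy \<gamma>\<^sub>1 \<gamma>\<^sub>2 u)"
  proof (rule INF_greatest)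
    fix u :: "real^'n \<Rightarrow> complex" assume u: "u \<in> mass_sphere 0"
    then have H1: "u \<in> H1" and m: "(\<integral>x. (norm (u x))\<^sup>2 \<partial>lborel) = 0" by (auto simp: mass_sphere_def)
    then obtain g where g: "u \<in> L2" "g \<in> L2" "is_weak_gradient u g" by (auto simp: H1_iff)
    have "riesz_energy \<gamma>\<^sub>1 u \<le> 0"
    proof (rule riesz_energy_le[of \<gamma>\<^sub>1, where 'n='n])
      fix K
      assume "\<And>u g \<delta>. (u :: real^'n \<Rightarrow> complex) \<in> L2 \<Longrightarrow> g \<in> L2 \<Longrightarrow> is_weak_gradient u g \<Longrightarrow> 0 < \<delta> \<Longrightarrow>
        riesz_energy \<gamma>\<^sub>1 u \<le> ennreal ((\<integral>x. (norm (u x))\<^sup>2 \<partial>lborel) *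
        (K * (\<delta> powr - \<gamma>\<^sub>1 * (\<integral>x. (norm (u x))\<^sup>2 \<partial>lborel) + \<delta> powr (2 - \<gamma>\<^sub>1) * (\<integral>x. (norm (g x))\<^sup>2 \<partial>lborel))))"
      from this[OF g zero_less_one] show ?thesis by (simp add: m)
    qed (use \<gamma> in auto)
    then show "0 \<le> energy \<gamma>\<^sub>1 \<gamma>\<^sub>2 u"
      by (subst energy_eq[OF g(2,3) riesz_energy_finite[OF H1]]) simp
  qed
qed

text \<open>Division and multiplication by \<open>sqrt c\<close> pass between the sphere of mass c
  and that of mass 1, one for each inequality.\<close>

lemma min_energy_eq_INF:
  assumes c: "0 < c"
  shows "min_energy TYPE('n) \<gamma>\<^sub>1 \<gamma>\<^sub>2 c = (INF (A, B)\<in>unit_mass_energies TYPE('n) \<gamma>\<^sub>1 \<gamma>\<^sub>2. ereal (c / 2 * A + c\<^sup>2 / 4 * B))"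
  unfolding min_energy_def
proof (rule antisym)
  show "(INF (A, B)\<in>unit_mass_energies TYPE('n) \<gamma>\<^sub>1 \<gamma>\<^sub>2. ereal (c / 2 * A + c\<^sup>2 / 4 * B)) \<le>
    (INF u\<in>(mass_sphere c :: (real^'n \<Rightarrow> complex) set). energy \<gamma>\<^sub>1 \<gamma>\<^sub>2 u)"
  proof (rule INF_greatest)
    fix u :: "real^'n \<Rightarrow> complex" assume u: "u \<in> mass_sphere c"
    then have H1: "u \<in> H1" and m: "(\<integral>x. (norm (u x))\<^sup>2 \<partial>lborel) = c" by (auto simp: mass_sphere_def)
    then obtain g where g: "u \<in> L2" "g \<in> L2" "is_weak_gradient u g" by (auto simp: H1_iff)
    let ?A = "(\<integral>x. (norm (g x))\<^sup>2 \<partial>lborel)" and ?D = "\<lambda>\<gamma>. enn2real (riesz_energy \<gamma> u)"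
    have "(?A / c, ?D \<gamma>\<^sub>2 / c\<^sup>2 - ?D \<gamma>\<^sub>1 / c\<^sup>2) \<in> unit_mass_energies TYPE('n) \<gamma>\<^sub>1 \<gamma>\<^sub>2"
      using unit_mass_energiesI[OF g zero_less_one, of "1 / sqrt c" \<gamma>\<^sub>2 \<gamma>\<^sub>1] c by (simp add: m power_divide)
    then have "(INF (A, B)\<in>unit_mass_energies TYPE('n) \<gamma>\<^sub>1 \<gamma>\<^sub>2. ereal (c / 2 * A + c\<^sup>2 / 4 * B)) \<le>
       ereal (c / 2 * (?A / c) + c\<^sup>2 / 4 * (?D \<gamma>\<^sub>2 / c\<^sup>2 - ?D \<gamma>\<^sub>1 / c\<^sup>2))"
      by (rule INF_lower2) simp
    also have "c / 2 * (?A / c) + c\<^sup>2 / 4 * (?D \<gamma>\<^sub>2 / c\<^sup>2 - ?D \<gamma>\<^sub>1 / c\<^sup>2) = 1/2 * ?A + 1/4 * (?D \<gamma>\<^sub>2 - ?D \<gamma>\<^sub>1)"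
      using c by (simp add: right_diff_distrib)
    finally show "(INF (A, B)\<in>unit_mass_energies TYPE('n) \<gamma>\<^sub>1 \<gamma>\<^sub>2. ereal (c / 2 * A + c\<^sup>2 / 4 * B)) \<le> energy \<gamma>\<^sub>1 \<gamma>\<^sub>2 u"
      by (subst energy_eq[OF g(2,3) riesz_energy_finite[OF H1]])
  qed
  show "(INF u\<in>(mass_sphere c :: (real^'n \<Rightarrow> complex) set). energy \<gamma>\<^sub>1 \<gamma>\<^sub>2 u) \<le>
    (INF (A, B)\<in>unit_mass_energies TYPE('n) \<gamma>\<^sub>1 \<gamma>\<^sub>2. ereal (c / 2 * A + c\<^sup>2 / 4 * B))"
  proof (rule INF_greatest, clarify)
    fix A B assume "(A, B) \<in> unit_mass_energies TYPE('n) \<gamma>\<^sub>1 \<gamma>\<^sub>2"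
    then obtain u :: "real^'n \<Rightarrow> complex" and g where g: "u \<in> L2" "g \<in> L2" "is_weak_gradient u g"
      and m: "(\<integral>x. (norm (u x))\<^sup>2 \<partial>lborel) = 1" and A: "A = (\<integral>x. (norm (g x))\<^sup>2 \<partial>lborel)"
      and B: "B = enn2real (riesz_energy \<gamma>\<^sub>2 u) - enn2real (riesz_energy \<gamma>\<^sub>1 u)"
      unfolding unit_mass_energies_def by blast
    let ?v = "\<lambda>x. sqrt c *\<^sub>R u x" and ?h = "\<lambda>x. sqrt c *\<^sub>R g x"
    have v: "?v \<in> L2" "?h \<in> L2" "is_weak_gradient ?v ?h"
      "(\<integral>x. (norm (?v x))\<^sup>2 \<partial>lborel) = c" "(\<integral>x. (norm (?h x))\<^sup>2 \<partial>lborel) = c * A"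
      using L2_affine[OF g(1) zero_less_one, of "sqrt c" 0] L2_affine[OF g(2) zero_less_one, of "sqrt c" 0]
        is_weak_gradient_affine[OF g zero_less_one, of "sqrt c" 0] c m A
      by simp_all
    have H1: "?v \<in> H1" using v by (auto simp: H1_iff)
    have "sqrt c ^ 4 = (sqrt c ^ 2) ^ 2" by (simp only: power_mult[symmetric]) simp
    then have "riesz_energy \<gamma> ?v = ennreal (c\<^sup>2) * riesz_energy \<gamma> u" for \<gamma>
      using riesz_energy_dilation[OF L2_measurable[OF g(1)] zero_less_one, of \<gamma> "sqrt c"] c by simp
    then have D: "enn2real (riesz_energy \<gamma> ?v) = c\<^sup>2 * enn2real (riesz_energy \<gamma> u)" for \<gamma>
      by (simp add: enn2real_mult)
    have "energy \<gamma>\<^sub>1 \<gamma>\<^sub>2 ?v = ereal (c / 2 * A + c\<^sup>2 / 4 * B)"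
      by (subst energy_eq[OF v(2,3) riesz_energy_finite[OF H1]]) (simp only: v D B, simp add: field_simps)
    moreover have "?v \<in> mass_sphere c" using v H1 by (simp add: mass_sphere_def)
    ultimately show "(INF u\<in>(mass_sphere c :: (real^'n \<Rightarrow> complex) set). energy \<gamma>\<^sub>1 \<gamma>\<^sub>2 u) \<le> ereal (c / 2 * A + c\<^sup>2 / 4 * B)"
      by (metis INF_lower)
  qed
qed

lemma unit_mass_energies_lower:
  assumes "0 < \<epsilon>"
  shows "\<exists>C. \<forall>(A, B)\<in>unit_mass_energies TYPE('n) \<gamma>\<^sub>1 \<gamma>\<^sub>2. - (\<epsilon> * A + C) \<le> B"
proof -
  have \<gamma>1: "0 < \<gamma>\<^sub>1" "\<gamma>\<^sub>1 < 2" "\<gamma>\<^sub>1 < real CARD('n)" using \<gamma> by auto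
  obtain K where K: "0 < K"
    "\<And>(u :: real^'n \<Rightarrow> complex) g \<delta>. u \<in> L2 \<Longrightarrow> g \<in> L2 \<Longrightarrow> is_weak_gradient u g \<Longrightarrow> 0 < \<delta> \<Longrightarrow>
      riesz_energy \<gamma>\<^sub>1 u \<le> ennreal ((\<integral>x. (norm (u x))\<^sup>2 \<partial>lborel) *
        (K * (\<delta> powr - \<gamma>\<^sub>1 * (\<integral>x. (norm (u x))\<^sup>2 \<partial>lborel) + \<delta> powr (2 - \<gamma>\<^sub>1) * (\<integral>x. (norm (g x))\<^sup>2 \<partial>lborel))))"
    by (rule riesz_energy_le[OF \<gamma>1]) blast
  \<comment> \<open>The radius at which the kinetic coefficient
    \<open>K * \<delta> powr (2 - \<gamma>\<^sub>1)\<close> equals \<epsilon>; solvable because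
    \<open>\<gamma>\<^sub>1 < 2\<close>.\<close>
  define \<delta> where "\<delta> = (\<epsilon> / K) powr (1 / (2 - \<gamma>\<^sub>1))"
  have \<delta>: "0 < \<delta>" "K * \<delta> powr (2 - \<gamma>\<^sub>1) = \<epsilon>"
    using assms K(1) \<gamma>1 by (auto simp: \<delta>_def powr_powr)
  have "- (\<epsilon> * A + K * \<delta> powr - \<gamma>\<^sub>1) \<le> B" if AB: "(A, B) \<in> unit_mass_energies TYPE('n) \<gamma>\<^sub>1 \<gamma>\<^sub>2" for A B
  proof -
    from AB obtain u :: "real^'n \<Rightarrow> complex" and g where g: "u \<in> L2" "g \<in> L2" "is_weak_gradient u g"
      and m: "(\<integral>x. (norm (u x))\<^sup>2 \<partial>lborel) = 1" and A: "A = (\<integral>x. (norm (g x))\<^sup>2 \<partial>lborel)"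
      and B: "B = enn2real (riesz_energy \<gamma>\<^sub>2 u) - enn2real (riesz_energy \<gamma>\<^sub>1 u)"
      unfolding unit_mass_energies_def by blast
    have "0 \<le> A" unfolding A by simp
    have "riesz_energy \<gamma>\<^sub>1 u \<le> ennreal (K * \<delta> powr - \<gamma>\<^sub>1 + \<epsilon> * A)"
      using K(2)[OF g \<delta>(1)] by (simp add: m A[symmetric] distrib_left mult.assoc[symmetric] \<delta>(2))
    then have "enn2real (riesz_energy \<gamma>\<^sub>1 u) \<le> K * \<delta> powr - \<gamma>\<^sub>1 + \<epsilon> * A"
      using \<open>0 \<le> A\<close> K(1) assms by (intro enn2real_leI) auto
    moreover have "0 \<le> enn2real (riesz_energy \<gamma>\<^sub>2 u)" by simp
    ultimately show ?thesis unfolding B by linarith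
  qed
  then show ?thesis by blast
qed

text \<open>The fixed state is a bump on the unit cube, whose weak gradient is its classical one.
  Since the cube has positive measure, its mass and its attractive Riesz energy are positive, which
  yields \<open>0 < d\<^sub>1\<close>.\<close>

lemma unit_mass_energies_family:
  obtains a d\<^sub>1 d\<^sub>2 where "0 < d\<^sub>1" "0 \<le> d\<^sub>2"
    "\<And>l. 0 < l \<Longrightarrow> (l\<^sup>2 * a, l powr \<gamma>\<^sub>2 * d\<^sub>2 - l powr \<gamma>\<^sub>1 * d\<^sub>1) \<in> unit_mass_energies TYPE('n) \<gamma>\<^sub>1 \<gamma>\<^sub>2"
proof -
  define \<phi> where "\<phi> = box_bump (0 :: real^'n) One 1"
  have \<phi>: "\<phi> \<in> test_functions" unfolding \<phi>_def by (rule box_bump_test_function) simp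
  define u where "u = (\<lambda>x. complex_of_real (\<phi> x))"
  define g where "g = (\<lambda>x. \<chi> i. complex_of_real (pderiv_vec i \<phi> x))"
  have L2_of_real: "(\<lambda>x. complex_of_real (\<psi> x)) \<in> L2" if "\<psi> \<in> test_functions" for \<psi> :: "real^'n \<Rightarrow> real"
    using test_function_L2[OF that] test_function_continuous[OF that, of UNIV]
    by (auto simp: L2_def intro!: borel_measurable_continuous_onI continuous_on_of_real)
  have g_L2: "g \<in> L2"
  proof -
    have "(\<lambda>x. complex_of_real (pderiv_vec i \<phi> x)) \<in> L2" for i
      by (intro L2_of_real test_functions_pderiv_vec \<phi>)
    then have i: "integrable lborel (\<lambda>x. \<Sum>i\<in>UNIV. (norm (complex_of_real (pderiv_vec i \<phi> x)))\<^sup>2)"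
      by (intro Bochner_Integration.integrable_sum) (simp add: L2_def)
    have "continuous_on UNIV g"
      unfolding g_def by (intro continuous_on_vec_lambda continuous_on_of_real test_function_continuous test_functions_pderiv_vec \<phi>)
    then have "g \<in> borel_measurable borel" by (rule borel_measurable_continuous_onI)
    moreover have "(norm (g x))\<^sup>2 = (\<Sum>i\<in>UNIV. (norm (complex_of_real (pderiv_vec i \<phi> x)))\<^sup>2)" for x
      by (simp add: g_def norm_vec_def L2_set_def sum_nonneg)
    ultimately show ?thesis using i by (simp add: L2_def)
  qed
  have u: "u \<in> L2" "g \<in> L2" "is_weak_gradient u g"
    unfolding u_def using g_L2 L2_of_real[OF \<phi>] is_weak_gradient_test_function[OF \<phi>] by (auto simp: g_def)
  have H1: "u \<in> H1" using u by (auto simp: H1_iff)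
  have nz: "\<not> (AE x in lborel. u x = 0)"
  proof
    assume "AE x in lborel. u x = 0"
    then have "AE x in lborel. x \<notin> box (0 :: real^'n) One"
      by eventually_elim (simp add: u_def \<phi>_def box_bump_eq_0_iff)
    then have "emeasure lborel (box (0 :: real^'n) One) = 0"
      by (simp add: AE_iff_measurable[OF _ refl])
    then show False by (simp add: emeasure_lborel_box_eq)
  qed
  define M where "M = (\<integral>x. (norm (u x))\<^sup>2 \<partial>lborel)"
  have "M \<noteq> 0"
    unfolding M_def using nz u(1) by (subst integral_nonneg_eq_0_iff_AE) (auto simp: L2_def)
  then have M: "0 < M" by (simp add: M_def order_less_le)
  have "enn2real (riesz_energy \<gamma>\<^sub>1 u) \<noteq> 0"
    using riesz_energy_pos[OF L2_measurable[OF u(1)] nz] riesz_energy_finite(1)[OF H1]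
    by (auto simp: enn2real_eq_0_iff)
  then have d1: "0 < enn2real (riesz_energy \<gamma>\<^sub>1 u) / M\<^sup>2"
    using M by (simp add: order_less_le enn2real_nonneg)
  show thesis
  proof (rule that[OF d1])
    show "0 \<le> enn2real (riesz_energy \<gamma>\<^sub>2 u) / M\<^sup>2" by simp
    fix l :: real assume l: "0 < l"
    \<comment> \<open>The amplitude that compensates both the mass \<open>M\<close> of the bump and
      the Jacobian of the dilation by \<open>l\<close>.\<close>
    have "(sqrt (l ^ CARD('n) / M))\<^sup>2 * (1 / l) ^ CARD('n) * M = 1"
      using l M by (simp add: power_one_over)
    then show "(l\<^sup>2 * ((\<integral>x. (norm (g x))\<^sup>2 \<partial>lborel) / M), l powr \<gamma>\<^sub>2 * (enn2real (riesz_energy \<gamma>\<^sub>2 u) / M\<^sup>2)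
      - l powr \<gamma>\<^sub>1 * (enn2real (riesz_energy \<gamma>\<^sub>1 u) / M\<^sup>2)) \<in> unit_mass_energies TYPE('n) \<gamma>\<^sub>1 \<gamma>\<^sub>2"
      unfolding M_def by (rule unit_mass_energiesI[OF u l])
  qed
qed

end

theorem proposition1p1:
  fixes \<gamma>\<^sub>1 \<gamma>\<^sub>2 :: real and m :: "real \<Rightarrow> ereal"
  assumes "0 < \<gamma>\<^sub>2" and "\<gamma>\<^sub>2 < \<gamma>\<^sub>1" and "\<gamma>\<^sub>1 < min (real CARD('n::finite)) 2"
  defines "m \<equiv> min_energy TYPE('n) \<gamma>\<^sub>1 \<gamma>\<^sub>2"
  shows "(\<forall>c\<ge>0. - \<infinity> < m c \<and> m c \<le> 0)
    \<and> (\<forall>c>0. isCont m c)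
    \<and> (\<forall>c c\<^sub>1 c\<^sub>2. 0 \<le> c\<^sub>1 \<and> 0 \<le> c\<^sub>2 \<and> c = c\<^sub>1 + c\<^sub>2 \<and> 0 < c \<longrightarrow> m c \<le> m c\<^sub>1 + m c\<^sub>2)
    \<and> antimono_on {0<..} m
    \<and> (m \<longlongrightarrow> 0) (at_right 0)
    \<and> (m \<longlongrightarrow> - \<infinity>) at_top"
proof (rule unit_mass_energies_family[OF assms(1-3)])
  fix a d\<^sub>1 d\<^sub>2 :: real
  assume family: "0 < d\<^sub>1" "0 \<le> d\<^sub>2"
    "\<And>l. 0 < l \<Longrightarrow> (l\<^sup>2 * a, l powr \<gamma>\<^sub>2 * d\<^sub>2 - l powr \<gamma>\<^sub>1 * d\<^sub>1) \<in> unit_mass_energies TYPE('n) \<gamma>\<^sub>1 \<gamma>\<^sub>2"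
  interpret mass_scaling "unit_mass_energies TYPE('n) \<gamma>\<^sub>1 \<gamma>\<^sub>2" a d\<^sub>1 d\<^sub>2 \<gamma>\<^sub>1 \<gamma>\<^sub>2
  proof unfold_locales
    show "0 \<le> A" if "(A, B) \<in> unit_mass_energies TYPE('n) \<gamma>\<^sub>1 \<gamma>\<^sub>2" for A B
      using that by (auto simp: unit_mass_energies_def)
  qed (fact assms(1,2) family unit_mass_energies_lower[OF assms(1-3)])+
  show ?thesis
    unfolding m_def by (intro min_properties min_energy_zero[OF assms(1-3)] min_energy_eq_INF[OF assms(1-3)])
qed

end
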